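(* Let $G$ be a directed 2-sp-graph with $k+1$ vertices and $n$ edges. Let $B\in\mathbb{R}^{(k+1)\times n}$ be the incidence matrix of $G$ and let $W\in\mathbb{R}^{n\times n}$ be the diagonal matrix of the graph-induced edge weights of $G$. Let $$U=\operatorname{col}(W^{1/2}B^T)\subset\mathbb{R}^n$$ be the column space of $W^{1/2}B^T$. Then for every coordinate $k$-subspace $E_I\subset\mathbb{R}^n$ (with $I\subseteq E(G)$, $|I|=k$), the largest principal angle $\theta_{\max}(U,E_I)$ equals either $\arccos(1/\sqrt n)$ or $\pi/2$.
   Context: Graphs are finite multigraphs. A 2-cycle is a pair of parallel edges joining two distinct vertices. A 2-sp-graph (2-connected series–parallel graph) is a graph obtained from a 2-cycle by a finite sequence of series extensions (subdivisions of edges) and parallel extensions (duplications of edges). For a graph $\Gamma$, $|\Gamma|$ denotes its number of edges. "Directed" means an arbitrary direction is chosen for each edge; the incidence matrix $B$ has rows indexed by vertices and columns indexed by edges, the column of $e$ having entries $+1$ and $-1$ at the two ends of $e$ (according to the direction of $e$) and zeros elsewhere. Coordinates of $\mathbb{R}^n$ are indexed by the edges; for $I\subseteq E(G)$, $E_I$ is the span of the standard basis vectors indexed by $I$. The space $U$ is $k$-dimensional; for $k$-dimensional subspaces $U,V$ with orthonormal basis matrices $Q_U,Q_V$, $\theta_{\max}(U,V)$ is the angle in $[0,\pi/2]$ whose cosine is the smallest singular value of $Q_U^TQ_V$. Two-terminal series–parallel graphs with ordered terminals $(l,r)$: a single edge joining $l$ and $r$; or a parallel composition $\Gamma_1\parallel\cdots\parallel\Gamma_p$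 of such graphs (all left terminals identified, all right terminals identified); or a series composition $\Gamma_1\circ\cdots\circ\Gamma_s$ (the right terminal of $\Gamma_i$ identified with the left terminal of $\Gamma_{i+1}$; the left terminal is that of $\Gamma_1$, the right terminal is that of $\Gamma_s$). Admissible decomposition tree of a 2-sp-graph $G$: choose terminals $(l,r)$ for which $G$ is a two-terminal series–parallel graph. The tree is rooted, its root is $G$, and the children of each non-leaf node are the parts of a series or parallel composition forming that node. Leaves are single edges. Along every root-to-leaf chain, the decompositions alternate in type, starting with a parallel decomposition at the root (into proper subgraphs) and ending with a series decomposition; below the root, one-part ("dummy") decompositions are allowed, in particular to make every chain end with a series decomposition. Thus each edge $e$ has a root-to-leaf chain $G\supset\Gamma_1\supseteq\Gamma_2\supseteq\cdots\supseteq\Gamma_{2d}=\{e\}$. Graph-induced weights: put $\varphi(x)=x(n-x)$, where $n=|G|$. Given terminals and an admissible decomposition tree, the graph-induced weight of $e$ is $$w_e=\frac{\varphi(|\Gamma_1|)}{\varphi(|\Gamma_2|)}\frac{\varphi(|\Gamma_3|)}{\varphi(|\Gamma_4|)}\cdots\frac{\varphi(|\Gamma_{2d-1}|)}{\varphi(|\Gamma_{2d}|)},$$ where $G\supset\Gamma_1\supseteq\cdots\supseteq\Gamma_{2d}=\{e\}$ is the chain of $e$. The terminals and the admissible tree may be chosen arbitrarily. *)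

theory Defs
  imports "HOL-Analysis.Analysis" "Graph_Theory.Digraph"
begin

section \<open>2-connected series-parallel graphs\<close>

text \<open>A directed multigraph is a \<^type>\<open>pre_digraph\<close>. Everything in this section only looks at
  the underlying undirected multigraph, that is, at the unordered pair of ends of each edge, so the
  directions of the edges are arbitrary.\<close>

definition ends :: "('v, 'e) pre_digraph \<Rightarrow> 'e \<Rightarrow> 'v set" where
  "ends G e = {tail G e, head G e}"

text \<open>Edges carry labels. In a series extension the subdivided edge leaves its label to one of its
  two halves. Either end may be chosen as \<open>u\<close>, and \<open>H\<close> is determined only up to edge directions,
  so every labelling and every direction of a 2-sp-graph is obtained.\<close>

inductive two_sp_graph :: "('v, 'e) pre_digraph \<Rightarrow> bool" where
  two_cycle:
    "\<lbrakk> u \<noteq> v; e \<noteq> e'; verts G = {u, v}; arcs G = {e, e'};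
       ends G e = {u, v}; ends G e' = {u, v} \<rbrakk> \<Longrightarrow> two_sp_graph G"
| series_extension:
    "\<lbrakk> two_sp_graph G; e \<in> arcs G; ends G e = {u, v}; w \<notin> verts G; e' \<notin> arcs G;
       verts H = insert w (verts G); arcs H = insert e' (arcs G);
       \<forall>f \<in> arcs G - {e}. ends H f = ends G f;
       ends H e = {u, w}; ends H e' = {w, v} \<rbrakk> \<Longrightarrow> two_sp_graph H"
| parallel_extension:
    "\<lbrakk> two_sp_graph G; e \<in> arcs G; e' \<notin> arcs G;
       verts H = verts G; arcs H = insert e' (arcs G);
       \<forall>f \<in> arcs G. ends H f = ends G f; ends H e' = ends G e \<rbrakk> \<Longrightarrow> two_sp_graph H"


section \<open>Decomposition trees\<close>

text \<open>A node of a decomposition tree of \<open>G\<close> stands for the subgraph of \<open>G\<close> formed by the edges at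
  the leaves below it, together with the ends of these edges.\<close>

datatype (leaves: 'e) sp_tree =
    Leaf 'e
  | Series "'e sp_tree list"
  | Parallel "'e sp_tree list"

definition node_verts :: "('v, 'e) pre_digraph \<Rightarrow> 'e sp_tree \<Rightarrow> 'v set" where
  "node_verts G t = (\<Union>e \<in> leaves t. ends G e)"

text \<open>\<open>decomposes G l r t\<close>: the subgraph of \<open>G\<close> formed by the edges of \<open>t\<close> is a two-terminal
  series-parallel graph with terminals \<open>(l, r)\<close>, composed as described by \<open>t\<close>. The composition of
  the parts inside \<open>G\<close> identifies terminals and nothing else: distinct parts have no edge in common,
  and their common vertices are exactly the identified terminals. In a series composition,
  \<open>vs ! i\<close> and \<open>vs ! Suc i\<close> are the terminals of the part \<open>ts ! i\<close>. Compositions with a single part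
  are allowed.\<close>

inductive decomposes :: "('v, 'e) pre_digraph \<Rightarrow> 'v \<Rightarrow> 'v \<Rightarrow> 'e sp_tree \<Rightarrow> bool"
  for G :: "('v, 'e) pre_digraph" where
  edge:
    "\<lbrakk> e \<in> arcs G; l \<noteq> r; ends G e = {l, r} \<rbrakk> \<Longrightarrow> decomposes G l r (Leaf e)"
| parallel:
    "\<lbrakk> ts \<noteq> []; \<forall>t \<in> set ts. decomposes G l r t;
       \<forall>i < length ts. \<forall>j < i. leaves (ts ! i) \<inter> leaves (ts ! j) = {} \<and>
         node_verts G (ts ! i) \<inter> node_verts G (ts ! j) = {l, r} \<rbrakk>
     \<Longrightarrow> decomposes G l r (Parallel ts)"
| series:
    "\<lbrakk> ts \<noteq> []; length vs = Suc (length ts); vs ! 0 = l; vs ! length ts = r;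
       \<forall>i < length ts. decomposes G (vs ! i) (vs ! Suc i) (ts ! i);
       \<forall>i < length ts. \<forall>j < i. leaves (ts ! i) \<inter> leaves (ts ! j) = {} \<and>
         node_verts G (ts ! i) \<inter> node_verts G (ts ! j) = (if i = Suc j then {vs ! i} else {}) \<rbrakk>
     \<Longrightarrow> decomposes G l r (Series ts)"

text \<open>The types of decomposition alternate along every root-to-leaf chain, and a leaf occurs only as
  a child of a series decomposition.\<close>

fun alternating_par :: "'e sp_tree \<Rightarrow> bool"
and alternating_ser :: "'e sp_tree \<Rightarrow> bool" where
  "alternating_par (Parallel ts) = (\<forall>t \<in> set ts. alternating_ser t)"
| "alternating_par (Leaf e) = False"
| "alternating_par (Series ts) = False"
| "alternating_ser (Series ts) = (\<forall>t \<in> set ts. (\<exists>e. t = Leaf e) \<or> alternating_par t)"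
| "alternating_ser (Leaf e) = False"
| "alternating_ser (Parallel ts) = False"

text \<open>A parallel decomposition is one into proper subgraphs iff it has at least two parts.\<close>

definition admissible_tree :: "('v, 'e) pre_digraph \<Rightarrow> 'v \<Rightarrow> 'v \<Rightarrow> 'e sp_tree \<Rightarrow> bool" where
  "admissible_tree G l r T \<longleftrightarrow>
     decomposes G l r T \<and> leaves T = arcs G \<and> node_verts G T = verts G \<and>
     alternating_par T \<and> (\<exists>ts. T = Parallel ts \<and> length ts \<ge> 2)"


section \<open>Graph-induced weights\<close>

text \<open>The chain \<open>[G, \<Gamma>\<^sub>1, \<dots>, \<Gamma>\<^sub>2\<^sub>d = {e}]\<close> of the edge \<open>e\<close>. Since the children of a node have no
  edge in common, exactly one child contributes to the concatenation.\<close>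

fun chain :: "'e sp_tree \<Rightarrow> 'e \<Rightarrow> 'e sp_tree list" where
  "chain (Leaf f) e = [Leaf f]"
| "chain (Series ts) e = Series ts # concat (map (\<lambda>t. if e \<in> leaves t then chain t e else []) ts)"
| "chain (Parallel ts) e = Parallel ts # concat (map (\<lambda>t. if e \<in> leaves t then chain t e else []) ts)"

definition phi :: "nat \<Rightarrow> nat \<Rightarrow> real" where
  "phi n x = real x * (real n - real x)"

definition graph_weight :: "'e sp_tree \<Rightarrow> 'e \<Rightarrow> real" where
  "graph_weight T e =
     (let n = card (leaves T); \<Gamma> = (\<lambda>i. leaves (chain T e ! i)); d = (length (chain T e) - 1) div 2
      in \<Prod>j = 1..d. phi n (card (\<Gamma> (2 * j - 1))) / phi n (card (\<Gamma> (2 * j))))"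


section \<open>Matrices and principal angles\<close>

definition incidence_matrix :: "('v::finite, 'e::finite) pre_digraph \<Rightarrow> real ^ 'e ^ 'v" where
  "incidence_matrix G = (\<chi> v e. if v = head G e then 1 else if v = tail G e then - 1 else 0)"

definition diag_matrix :: "('n::finite \<Rightarrow> real) \<Rightarrow> real ^ 'n ^ 'n" where
  "diag_matrix w = (\<chi> i j. if i = j then w i else 0)"

text \<open>For a diagonal matrix with nonnegative entries, \<open>diag_sqrt W\<close> is \<open>W\<^sup>1\<^sup>/\<^sup>2\<close>.\<close>

definition diag_sqrt :: "real ^ 'n ^ 'n \<Rightarrow> real ^ 'n ^ 'n" where
  "diag_sqrt W = (\<chi> i j. sqrt (W $ i $ j))"

definition col_space :: "real ^ 'm ^ 'n \<Rightarrow> (real ^ 'n) set" where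
  "col_space A = span (columns A)"

definition coordinate_subspace :: "'n::finite set \<Rightarrow> (real ^ 'n) set" where
  "coordinate_subspace I = span ((\<lambda>i. axis i 1) ` I)"

definition orthonormal_basis_matrix :: "real ^ 'k ^ 'n \<Rightarrow> (real ^ 'n) set \<Rightarrow> bool" where
  "orthonormal_basis_matrix Q U \<longleftrightarrow> transpose Q ** Q = mat 1 \<and> col_space Q = U"

definition singular_values :: "real ^ 'k ^ 'k \<Rightarrow> real set" where
  "singular_values A = {sqrt c | c. \<exists>x. x \<noteq> 0 \<and> (transpose A ** A) *v x = c *\<^sub>R x}"

text \<open>The type argument fixes the common dimension \<open>CARD('k)\<close> of the two subspaces.\<close>

definition theta_max :: "'k::finite itself \<Rightarrow> (real ^ 'n) set \<Rightarrow> (real ^ 'n) set \<Rightarrow> real" where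
  "theta_max _ U V = (THE \<theta>. 0 \<le> \<theta> \<and> \<theta> \<le> pi / 2 \<and>
     (\<exists>(Q\<^sub>U :: real ^ 'k ^ 'n) (Q\<^sub>V :: real ^ 'k ^ 'n).
        orthonormal_basis_matrix Q\<^sub>U U \<and> orthonormal_basis_matrix Q\<^sub>V V \<and>
        cos \<theta> = Min (singular_values (transpose Q\<^sub>U ** Q\<^sub>V))))"

end

theory Submission
  imports Defs
begin

text \<open>
  Write \<open>x\<close> for a potential on the vertices and \<open>dx\<close> for its differences along the
  edges, so that \<open>U\<close> consists of the vectors with entries \<open>sqrt (w e) * dx e\<close>. The squared cosine of the
  largest principal angle between \<open>U\<close> and \<open>E\<^sub>I\<close> is the minimum over nonzero \<open>u \<in> U\<close> of the portion of
  \<open>u \<bullet> u\<close> that is carried by the coordinates in \<open>I\<close> (\<open>theta_max_coordinate_subspace\<close>). If some nonconstant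
  potential is constant along every edge of \<open>I\<close>, this minimum is \<open>0\<close> and the angle is a right angle. It
  remains to see that otherwise, when \<open>I\<close> is a spanning tree, the minimum is \<open>1 / n\<close>; in other words
  that the quadratic form
    \<open>energy x = (\<Sum>e. (n * [e \<in> I] - 1) * w e * (dx e)\<^sup>2)\<close>
  is nonnegative and vanishes at some nonconstant potential.

  The form is minimised part by part along the decomposition tree. For a
  part with \<open>m\<close> edges and terminals \<open>l, r\<close>, minimising the energy of the part over the values
  at its inner vertices leaves \<open>c * (x r - x l)\<^sup>2\<close>, a single edge of conductance \<open>c\<close>. With the weights
  normalised inside the part, the conductance depends on nothing but \<open>m\<close> and on whether \<open>I\<close> joins the two
  terminals inside the part: it is \<open>n - m\<close> if so, and \<open>- m\<close> if not
  (\<open>energy_reduces\<close>). A single edge satisfies this by definition. Conductances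
  add up in a parallel composition, where at most one part is joined because \<open>I\<close> has no cycle. In a series
  composition the inverses of the conductances add up. The weight of a child is scaled there by the
  quotient of \<open>\<phi> m = m * (n - m)\<close> and \<open>\<phi> m\<^sub>i\<close>, and so \<open>n - m\<^sub>i\<close> becomes \<open>\<phi> m / m\<^sub>i\<close> while \<open>- m\<^sub>i\<close> becomes
  \<open>- \<phi> m / (n - m\<^sub>i)\<close>. Up to the factor \<open>\<phi> m\<close> the inverses are therefore \<open>m\<^sub>i\<close> and \<open>- (n - m\<^sub>i)\<close>, and they sum
  to \<open>m\<close> when all parts are joined and to \<open>- (n - m)\<close> when exactly one is not. This
  is the reason for the choice of the weights. For the whole graph \<open>m = n\<close>, and
  the conductance \<open>n - m\<close> is \<open>0\<close>: the form is nonnegative and vanishes at a potential with different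
  values at the two terminals.

  Three recursive predicates replace the notion of spanning tree: \<open>I\<close> connects the
  terminals, no series node has two parts that \<open>I\<close> leaves unconnected, and no parallel node has two parts
  that \<open>I\<close> connects. If one of the first two fails at the root, a nonconstant potential that is constant
  along \<open>I\<close> is written down directly (\<open>flat_potential\<close>, \<open>isolated_potential\<close>). If both hold, the third
  follows by counting, since \<open>I\<close> has only \<open>k\<close> edges (\<open>card_inner_verts_le\<close>).
\<close>

section \<open>Edge differences and parts of a decomposition\<close>

definition edge_diff :: "('v, 'e) pre_digraph \<Rightarrow> ('v \<Rightarrow> real) \<Rightarrow> 'e \<Rightarrow> real" where
  "edge_diff G x e = x (head G e) - x (tail G e)"

definition part_edges_disjoint :: "'e sp_tree list \<Rightarrow> bool" where
  "part_edges_disjoint ts \<longleftrightarrow> (\<forall>i < length ts. \<forall>j < i. leaves (ts ! i) \<inter> leaves (ts ! j) = {})"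

text \<open>Squares of differences do not see the direction of an edge, so the energies below depend only on the
  underlying undirected graph.\<close>

lemma ends_sq_diff:
  assumes "ends G e = {l, r}"
  shows "(edge_diff G x e)\<^sup>2 = (x r - x l)\<^sup>2"
  using assms by (auto simp: ends_def edge_diff_def doubleton_eq_iff power2_commute)

lemma edge_diff_cong:
  assumes "\<And>v. v \<in> ends G e \<Longrightarrow> x v = y v"
  shows "edge_diff G x e = edge_diff G y e"
  using assms by (simp add: ends_def edge_diff_def)

lemma edge_diff_cong_node:
  assumes "\<And>v. v \<in> node_verts G t \<Longrightarrow> x v = y v" "e \<in> leaves t"
  shows "edge_diff G x e = edge_diff G y e"
  using assms by (intro edge_diff_cong) (auto simp: node_verts_def)

lemma finite_leaves: "finite (leaves t)"
  by (induction t) auto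

lemma leaves_as_UN_nth:
  "leaves (Parallel ts) = (\<Union>i<length ts. leaves (ts ! i))"
  "leaves (Series ts) = (\<Union>i<length ts. leaves (ts ! i))"
  by (simp add: set_conv_nth; blast)+

lemma node_verts_as_UN_nth:
  "node_verts G (Leaf e) = ends G e"
  "node_verts G (Parallel ts) = (\<Union>i<length ts. node_verts G (ts ! i))"
  "node_verts G (Series ts) = (\<Union>i<length ts. node_verts G (ts ! i))"
  unfolding node_verts_def leaves_as_UN_nth by auto

lemma part_edges_disjointD:
  assumes "part_edges_disjoint ts" "i < length ts" "j < length ts" "i \<noteq> j"
  shows "leaves (ts ! i) \<inter> leaves (ts ! j) = {}"
  using assms unfolding part_edges_disjoint_def by (metis Int_commute nat_neq_iff)

lemma sum_leaves:
  assumes "part_edges_disjoint ts"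
  shows "sum f (leaves (Parallel ts)) = (\<Sum>i<length ts. sum f (leaves (ts ! i)))"
    and "sum f (leaves (Series ts)) = (\<Sum>i<length ts. sum f (leaves (ts ! i)))"
  unfolding leaves_as_UN_nth
  by (intro sum.UNION_disjoint; use part_edges_disjointD[OF assms] in \<open>auto simp: finite_leaves\<close>)+

lemma card_leaves:
  assumes "part_edges_disjoint ts"
  shows "card (leaves (Parallel ts)) = (\<Sum>i<length ts. card (leaves (ts ! i)))"
    and "card (leaves (Series ts)) = (\<Sum>i<length ts. card (leaves (ts ! i)))"
  using sum_leaves[OF assms, of "\<lambda>_. 1::nat"] by simp_all

text \<open>The shape in which the chain of an edge selects the child that contains it. The node weights below are
  written in the same shape in order to share this lemma.\<close>

lemma concat_map_unique_part:
  assumes "part_edges_disjoint ts" "i < length ts" "e \<in> leaves (ts ! i)"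
  shows "concat (map (\<lambda>t. if e \<in> leaves t then f t else []) ts) = f (ts ! i)"
proof -
  define g where "g = (\<lambda>t. if e \<in> leaves t then f t else [])"
  have ts: "ts = take i ts @ ts ! i # drop (Suc i) ts"
    using assms(2) by (simp add: id_take_nth_drop)
  have out: "e \<notin> leaves (ts ! j)" if "j < length ts" "j \<noteq> i" for j
    using part_edges_disjointD[OF assms(1) assms(2) that(1)] that(2) assms(3) by auto
  have "g t = []" if "t \<in> set (take i ts) \<union> set (drop (Suc i) ts)" for t
    using that out assms(2) by (auto simp: g_def in_set_conv_nth)
  then have "concat (map g (take i ts)) = []" "concat (map g (drop (Suc i) ts)) = []"
    unfolding concat_eq_Nil_conv set_map by blast+
  moreover have "concat (map g ts) = 
      concat (map g (take i ts)) @ g (ts ! i) @ concat (map g (drop (Suc i) ts))"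
    by (subst ts) (simp only: map_append concat_append list.map concat.simps)
  moreover have "g (ts ! i) = f (ts ! i)" using assms(3) by (simp add: g_def)
  ultimately have "concat (map g ts) = f (ts ! i)" by (metis append_Nil append_Nil2)
  then show ?thesis by (simp only: g_def)
qed

lemma decomposes_part_edges_disjoint:
  "decomposes G l r (Parallel ts) \<Longrightarrow> part_edges_disjoint ts"
  "decomposes G l r (Series ts) \<Longrightarrow> part_edges_disjoint ts"
  by (erule decomposes.cases; simp add: part_edges_disjoint_def)+

lemma terminals_in_node_verts:
  "decomposes G l r t \<Longrightarrow> l \<in> node_verts G t \<and> r \<in> node_verts G t"
proof (induction rule: decomposes.induct)
  case (edge e l r)
  then show ?case by (simp add: node_verts_as_UN_nth)
next
  case (parallel ts l r)
  then have "ts ! 0 \<in> set ts" "0 < length ts" by auto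
  then show ?case using parallel unfolding node_verts_as_UN_nth by blast
next
  case (series ts vs l r)
  let ?m = "length ts - 1"
  have m: "0 < length ts" "?m < length ts" "Suc ?m = length ts" using series by auto
  have "vs ! 0 \<in> node_verts G (ts ! 0)" "vs ! Suc ?m \<in> node_verts G (ts ! ?m)"
    using series.IH m(1,2) by blast+
  then have "l \<in> node_verts G (ts ! 0)" "r \<in> node_verts G (ts ! ?m)"
    using series.hyps m(3) by simp_all
  then show ?case using m unfolding node_verts_as_UN_nth by blast
qed

text \<open>Two parts of a series composition meet in the cut vertex between them if they are consecutive, and
  not at all otherwise. A repeated cut vertex would force a part to have equal terminals.\<close>

lemma series_cut_vertices_distinct:
  assumes parts: "\<forall>i < m. vs ! i \<noteq> vs ! Suc i \<and> vs ! i \<in> N i \<and> vs ! Suc i \<in> N i"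
    and meet: "\<forall>i < m. \<forall>j < i. N i \<inter> N j = (if i = Suc j then {vs ! i} else {})"
    and ij: "i \<le> m" "j < i"
  shows "vs ! i \<noteq> vs ! j"
proof
  assume eq: "vs ! i = vs ! j"
  obtain p where p: "i = Suc p" using ij by (cases i) simp_all
  have pm: "p < m" and jm: "j < m" and jp: "j \<le> p" using ij p by simp_all
  have in_p: "vs ! i \<in> N p" and ne: "vs ! p \<noteq> vs ! i" and in_j: "vs ! j \<in> N j"
    using parts[rule_format, OF pm] parts[rule_format, OF jm] p by simp_all
  have "p \<noteq> j" using ne eq by auto
  then have "j < p" using jp by simp
  then have "N p \<inter> N j = (if p = Suc j then {vs ! p} else {})"
    using meet pm by blast
  moreover have "vs ! i \<in> N p \<inter> N j" using in_p in_j eq by simp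
  ultimately have "vs ! i \<in> (if p = Suc j then {vs ! p} else {})" by (simp only:)
  then show False using ne by (simp split: if_splits)
qed

lemma terminals_distinct: "decomposes G l r t \<Longrightarrow> l \<noteq> r"
proof (induction rule: decomposes.induct)
  case (parallel ts l r)
  then have "hd ts \<in> set ts" by simp
  then show ?case using parallel.IH by blast
next
  case (series ts vs l r)
  have "vs ! length ts \<noteq> vs ! 0"
  proof (rule series_cut_vertices_distinct[where m = "length ts" and N = "\<lambda>i. node_verts G (ts ! i)"])
    show "\<forall>i<length ts. vs ! i \<noteq> vs ! Suc i \<and> vs ! i \<in> node_verts G (ts ! i) \<and>
      vs ! Suc i \<in> node_verts G (ts ! i)"
    proof (intro allI impI)
      fix i assume "i < length ts"
      then have "decomposes G (vs ! i) (vs ! Suc i) (ts ! i)" "vs ! i \<noteq> vs ! Suc i"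
        using series.IH by simp_all
      then show "vs ! i \<noteq> vs ! Suc i \<and> vs ! i \<in> node_verts G (ts ! i) \<and>
        vs ! Suc i \<in> node_verts G (ts ! i)"
        using terminals_in_node_verts by fast
    qed
    show "\<forall>i<length ts. \<forall>j<i. node_verts G (ts ! i) \<inter> node_verts G (ts ! j) =
      (if i = Suc j then {vs ! i} else {})"
      by (intro allI impI conjunct2[OF series.hyps(5)[rule_format]])
    show "0 < length ts" using series.hyps(1) by simp
  qed simp
  then show ?case using series.hyps(3,4) by simp
qed

text \<open>Parts of a composition share only terminals, so potentials on the parts that agree there are
  restrictions of one potential. The following versions provide this for the two kinds of composition,
  at first for the vertex sets and then for decomposed nodes, with an arbitrary local property \<open>P\<close> of the
  partial potentials.\<close>

lemma glue_potentials:
  assumes "\<And>i j v. i < m \<Longrightarrow> j < i \<Longrightarrow> v \<in> N i \<Longrightarrow> v \<in> N j \<Longrightarrow> xs i v = xs j v"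
  shows "\<exists>x. \<forall>i < (m::nat). \<forall>v \<in> N i. x v = (xs i v :: real)"
proof -
  define x where "x v = xs (SOME j. j < m \<and> v \<in> N j) v" for v
  have "x v = xs i v" if i: "i < m" "v \<in> N i" for i v
  proof -
    obtain j where j: "j = (SOME j. j < m \<and> v \<in> N j)" by simp
    have "\<exists>j. j < m \<and> v \<in> N j" using i by blast
    from someI_ex[OF this] have "j < m \<and> v \<in> N j" unfolding j .
    then consider "j < i" "v \<in> N j" | "i = j" | "i < j" "j < m" "v \<in> N j" by linarith
    then have "xs j v = xs i v"
    proof cases
      case 1
      then show ?thesis using assms[OF i(1) _ i(2)] by metis
    next
      case 3
      then show ?thesis using assms[of j i v] i by blast
    qed simp
    then show ?thesis unfolding x_def j .
  qed
  then show ?thesis by blast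
qed

lemma glue_parallel:
  assumes "\<And>i. i < m \<Longrightarrow> xs i l = a \<and> xs i r = b"
    and "\<And>i j. i < m \<Longrightarrow> j < i \<Longrightarrow> N i \<inter> N j = {l, r}"
  shows "\<exists>x. \<forall>i < (m::nat). \<forall>v \<in> N i. x v = (xs i v :: real)"
proof (rule glue_potentials)
  fix i j v assume *: "i < m" "j < i" "v \<in> N i" "v \<in> N j"
  then have "v = l \<or> v = r" using assms(2) by blast
  then show "xs i v = xs j v" using assms(1)[of i] assms(1)[of j] * by auto
qed

lemma glue_series:
  assumes "\<And>i. i < m \<Longrightarrow> xs i (vs ! i) = y i \<and> xs i (vs ! Suc i) = y (Suc i)"
    and "\<And>i j. i < m \<Longrightarrow> j < i \<Longrightarrow> N i \<inter> N j = (if i = Suc j then {vs ! i} else {})"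
  shows "\<exists>x. \<forall>i < (m::nat). \<forall>v \<in> N i. x v = (xs i v :: real)"
proof (rule glue_potentials)
  fix i j v assume *: "i < m" "j < i" "v \<in> N i" "v \<in> N j"
  then have "v \<in> N i \<inter> N j" by blast
  then have "v \<in> (if i = Suc j then {vs ! i} else {})" using assms(2)[of i j] * by (simp only:)
  then have "i = Suc j" "v = vs ! i" by (auto split: if_splits)
  then show "xs i v = xs j v" using assms(1)[of i] assms(1)[of j] * by simp
qed

text \<open>Connectedness of the subgraph at a node, in the form in which it is used: a potential without
  differences is constant.\<close>

lemma potential_constant:
  assumes "decomposes G l r t" "\<And>e. e \<in> leaves t \<Longrightarrow> edge_diff G x e = 0"
    "v \<in> node_verts G t"
  shows "x v = x l"
  using assms
proof (induction arbitrary: v rule: decomposes.induct)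
  case (edge e l r)
  have "(x r - x l)\<^sup>2 = 0"
    using ends_sq_diff[OF edge.hyps(3), of x] edge.prems(1)[of e] by simp
  moreover have "v = l \<or> v = r"
    using edge.prems(2) edge.hyps(3) by (simp add: node_verts_as_UN_nth)
  ultimately show ?case by auto
next
  case (parallel ts l r)
  from parallel.prems(2) obtain t where t: "t \<in> set ts" "v \<in> node_verts G t"
    by (auto simp: node_verts_def)
  then have "edge_diff G x e = 0" if "e \<in> leaves t" for e
    using that parallel.prems(1)[of e] by auto
  then show ?case using parallel.IH t by blast
next
  case (series ts vs l r)
  have part: "edge_diff G x e = 0" if "i < length ts" "e \<in> leaves (ts ! i)" for i e
    using series.prems(1) that unfolding leaves_as_UN_nth by blast
  have IH: "x v = x (vs ! i)" if "i < length ts" "v \<in> node_verts G (ts ! i)" for i v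
    using series.IH part[OF that(1)] that by blast
  have cut: "x (vs ! i) = x (vs ! 0)" if "i \<le> length ts" for i
    using that
  proof (induction i)
    case (Suc i)
    then have "decomposes G (vs ! i) (vs ! Suc i) (ts ! i)" using series.IH by simp
    then have "vs ! Suc i \<in> node_verts G (ts ! i)" by (blast dest: terminals_in_node_verts)
    then have "x (vs ! Suc i) = x (vs ! i)"
      using IH[of i] Suc.prems by simp
    then show ?case using Suc by simp
  qed simp
  from series.prems(2) obtain i where i: "i < length ts" "v \<in> node_verts G (ts ! i)"
    by (auto simp: node_verts_as_UN_nth)
  show ?case using IH[OF i] cut[of i] i(1) series.hyps(3) by simp
qed

lemma glue_over_parallel:
  assumes dec: "decomposes G l r (Parallel ts)"
    and local: "\<And>i x y. i < length ts \<Longrightarrow> \<forall>v \<in> node_verts G (ts ! i). x v = y v \<Longrightarrow> P i x \<Longrightarrow> P i y"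
    and parts: "\<And>i. i < length ts \<Longrightarrow> \<exists>x :: 'v \<Rightarrow> real. x l = a \<and> x r = b \<and> P i x"
  shows "\<exists>x :: 'v \<Rightarrow> real. x l = a \<and> x r = b \<and> (\<forall>i < length ts. P i x)"
proof -
  from dec have ne: "ts \<noteq> []" and sub: "\<forall>t \<in> set ts. decomposes G l r t"
    and meet: "\<forall>i < length ts. \<forall>j < i. leaves (ts ! i) \<inter> leaves (ts ! j) = {} \<and>
         node_verts G (ts ! i) \<inter> node_verts G (ts ! j) = {l, r}"
    by (blast elim: decomposes.cases)+
  have "\<forall>i \<in> {..<length ts}. \<exists>x :: 'v \<Rightarrow> real. x l = a \<and> x r = b \<and> P i x"
    using parts by blast
  from bchoice[OF this] obtain xs :: "nat \<Rightarrow> 'v \<Rightarrow> real"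
    where xs: "i < length ts \<Longrightarrow> xs i l = a \<and> xs i r = b \<and> P i (xs i)" for i by blast
  have "\<exists>x. \<forall>i < length ts. \<forall>v \<in> node_verts G (ts ! i). x v = xs i v"
  proof (rule glue_parallel)
    fix i assume "i < length ts"
    then show "xs i l = a \<and> xs i r = b" using xs by blast
  next
    fix i j assume "i < length ts" "j < i"
    then show "node_verts G (ts ! i) \<inter> node_verts G (ts ! j) = {l, r}" using meet by blast
  qed
  then obtain x where x: "i < length ts \<Longrightarrow> v \<in> node_verts G (ts ! i) \<Longrightarrow> x v = xs i v" for i v
    by blast
  have "l \<in> node_verts G (ts ! 0)" "r \<in> node_verts G (ts ! 0)"
    using sub ne terminals_in_node_verts by (metis length_greater_0_conv nth_mem)+
  then have "x l = a" "x r = b" using x[of 0] xs[of 0] ne by auto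
  moreover have "P i x" if "i < length ts" for i
    using local[OF that, of "xs i" x] x[OF that] xs[OF that] by simp
  ultimately show ?thesis by blast
qed

lemma glue_over_series:
  assumes ne: "ts \<noteq> []"
    and sub: "\<forall>i < length ts. decomposes G (vs ! i) (vs ! Suc i) (ts ! i)"
    and meet: "\<forall>i < length ts. \<forall>j < i. leaves (ts ! i) \<inter> leaves (ts ! j) = {} \<and>
         node_verts G (ts ! i) \<inter> node_verts G (ts ! j) = (if i = Suc j then {vs ! i} else {})"
    and local: "\<And>i x y. i < length ts \<Longrightarrow> \<forall>v \<in> node_verts G (ts ! i). x v = y v \<Longrightarrow> P i x \<Longrightarrow> P i y"
    and parts: "\<And>i. i < length ts \<Longrightarrow>
      \<exists>x :: 'v \<Rightarrow> real. x (vs ! i) = h i \<and> x (vs ! Suc i) = h (Suc i) \<and> P i x"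
  shows "\<exists>x :: 'v \<Rightarrow> real. (\<forall>i \<le> length ts. x (vs ! i) = h i) \<and> (\<forall>i < length ts. P i x)"
proof -
  have "\<forall>i \<in> {..<length ts}. \<exists>x :: 'v \<Rightarrow> real. x (vs ! i) = h i \<and> x (vs ! Suc i) = h (Suc i) \<and> P i x"
    using parts by blast
  from bchoice[OF this] obtain xs :: "nat \<Rightarrow> 'v \<Rightarrow> real"
    where xs: "i < length ts \<Longrightarrow> xs i (vs ! i) = h i \<and> xs i (vs ! Suc i) = h (Suc i) \<and> P i (xs i)"
    for i by blast
  have "\<exists>x. \<forall>i < length ts. \<forall>v \<in> node_verts G (ts ! i). x v = xs i v"
  proof (rule glue_series[where vs = vs and y = h])
    fix i assume "i < length ts"
    then show "xs i (vs ! i) = h i \<and> xs i (vs ! Suc i) = h (Suc i)" using xs by blast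
  next
    fix i j assume "i < length ts" "j < i"
    then show "node_verts G (ts ! i) \<inter> node_verts G (ts ! j) = (if i = Suc j then {vs ! i} else {})"
      using meet by blast
  qed
  then obtain x where x: "i < length ts \<Longrightarrow> v \<in> node_verts G (ts ! i) \<Longrightarrow> x v = xs i v" for i v
    by blast
  have ends_in: "vs ! i \<in> node_verts G (ts ! i)" "vs ! Suc i \<in> node_verts G (ts ! i)"
    if "i < length ts" for i
    using sub that by (blast dest: terminals_in_node_verts)+
  have "x (vs ! i) = h i" if i_le: "i \<le> length ts" for i
  proof (cases "i < length ts")
    case True
    then show ?thesis using x ends_in(1) xs by simp
  next
    case False
    then obtain p where p: "i = Suc p" "p < length ts"
      using i_le ne False by (cases i) auto
    then show ?thesis using x[OF p(2) ends_in(2)[OF p(2)]] xs[OF p(2)] by simp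
  qed
  moreover have "P i x" if "i < length ts" for i
    using local[OF that, of "xs i" x] x[OF that] xs[OF that] by simp
  ultimately show ?thesis by blast
qed


section \<open>How an edge set meets a decomposition tree\<close>

fun connects :: "'e set \<Rightarrow> 'e sp_tree \<Rightarrow> bool" where
  "connects I (Leaf e) \<longleftrightarrow> e \<in> I"
| "connects I (Series ts) \<longleftrightarrow> (\<forall>t \<in> set ts. connects I t)"
| "connects I (Parallel ts) \<longleftrightarrow> (\<exists>t \<in> set ts. connects I t)"

text \<open>If two parts of a series composition are unconnected by \<open>I\<close>, the vertices between them are cut off
  from both terminals. When this happens nowhere, every vertex of the node is joined by \<open>I\<close> to a terminal.\<close>

fun reaches :: "'e set \<Rightarrow> 'e sp_tree \<Rightarrow> bool" where
  "reaches I (Leaf e) \<longleftrightarrow> True"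
| "reaches I (Series ts) \<longleftrightarrow>
     (\<forall>t \<in> set ts. reaches I t) \<and> length (filter (\<lambda>t. \<not> connects I t) ts) \<le> 1"
| "reaches I (Parallel ts) \<longleftrightarrow> (\<forall>t \<in> set ts. reaches I t)"

text \<open>Two connected parts of a parallel composition close a cycle in \<open>I\<close>.\<close>

fun cycle_free :: "'e set \<Rightarrow> 'e sp_tree \<Rightarrow> bool" where
  "cycle_free I (Leaf e) \<longleftrightarrow> True"
| "cycle_free I (Series ts) \<longleftrightarrow> (\<forall>t \<in> set ts. cycle_free I t)"
| "cycle_free I (Parallel ts) \<longleftrightarrow>
     (\<forall>t \<in> set ts. cycle_free I t) \<and> length (filter (connects I) ts) \<le> 1"

definition flat :: "('v, 'e) pre_digraph \<Rightarrow> 'e set \<Rightarrow> 'e sp_tree \<Rightarrow> ('v \<Rightarrow> real) \<Rightarrow> bool" where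
  "flat G I t x \<longleftrightarrow> (\<forall>e \<in> I \<inter> leaves t. edge_diff G x e = 0)"

lemma flat_local:
  assumes "\<forall>v \<in> node_verts G t. x v = y v" "flat G I t x"
  shows "flat G I t y"
  using assms edge_diff_cong_node[of G t x y] by (auto simp: flat_def)

lemma flat_nodes:
  "flat G I (Parallel ts) x \<longleftrightarrow> (\<forall>i < length ts. flat G I (ts ! i) x)"
  "flat G I (Series ts) x \<longleftrightarrow> (\<forall>i < length ts. flat G I (ts ! i) x)"
  unfolding flat_def leaves_as_UN_nth by blast+

lemma flat_const: "flat G I t (\<lambda>_. c)"
  by (simp add: flat_def edge_diff_def)

lemma length_filter_le_1_iff:
  "length (filter P ts) \<le> 1 \<longleftrightarrow>
    (\<forall>i < length ts. \<forall>j < i. \<not> (P (ts ! i) \<and> P (ts ! j)))" (is "?L \<longleftrightarrow> ?R")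
proof -
  have "?L \<longleftrightarrow> (\<forall>i \<in> {i. i < length ts \<and> P (ts ! i)}. \<forall>j \<in> {i. i < length ts \<and> P (ts ! i)}. i = j)"
    unfolding length_filter_conv_card One_nat_def by (rule card_le_Suc0_iff_eq) simp
  also have "\<dots> \<longleftrightarrow> ?R"
    by (smt (verit) mem_Collect_eq nat_neq_iff order.strict_trans)
  finally show ?thesis .
qed

text \<open>The values at the terminals can be prescribed independently as soon as \<open>I\<close> does not connect them: in a
  series composition the jump from \<open>a\<close> to \<open>b\<close> is put into one unconnected part.\<close>

lemma flat_potential:
  assumes "decomposes G l r t" "connects I t \<Longrightarrow> a = b"
  shows "\<exists>x. x l = a \<and> x r = b \<and> flat G I t x"
  using assms
proof (induction arbitrary: a b rule: decomposes.induct)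
  case (edge e l r)
  show ?case
  proof (cases "e \<in> I")
    case True
    then show ?thesis using edge flat_const[of G I "Leaf e" a] by auto
  next
    case False
    then show ?thesis using edge.hyps(2)
      by (intro exI[of _ "\<lambda>v. if v = l then a else b"]) (simp add: flat_def)
  qed
next
  case (parallel ts l r)
  have dec: "decomposes G l r (Parallel ts)"
    by (rule decomposes.parallel[OF parallel.hyps(1) _ parallel.hyps(2)]) (use parallel.IH in blast)
  show ?case
  proof (cases "connects I (Parallel ts)")
    case True
    then show ?thesis using parallel.prems flat_const[of G I "Parallel ts" a]
      by (intro exI[of _ "\<lambda>_. a"]) simp
  next
    case False
    have parts: "\<exists>x. x l = a \<and> x r = b \<and> flat G I (ts ! i) x" if "i < length ts" for i
    proof -
      have "ts ! i \<in> set ts" using that by simp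
      moreover from this have "\<not> connects I (ts ! i)" using False by auto
      ultimately show ?thesis using bspec[OF parallel.IH, of "ts ! i"] by simp
    qed
    show ?thesis unfolding flat_nodes
      by (rule glue_over_parallel[where P = "\<lambda>i. flat G I (ts ! i)", OF dec _ parts]) (rule flat_local)
  qed
next
  case (series ts vs l r)
  have sub: "\<forall>i < length ts. decomposes G (vs ! i) (vs ! Suc i) (ts ! i)"
    using series.IH by blast
  show ?case
  proof (cases "connects I (Series ts)")
    case True
    then show ?thesis using series.prems flat_const[of G I "Series ts" a]
      by (intro exI[of _ "\<lambda>_. a"]) simp
  next
    case False
    then obtain j where j: "j < length ts" "\<not> connects I (ts ! j)"
      by (auto simp: in_set_conv_nth)
    define h where "h i = (if i \<le> j then a else b)" for i
    have parts: "\<exists>x. x (vs ! i) = h i \<and> x (vs ! Suc i) = h (Suc i) \<and> flat G I (ts ! i) x"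
      if "i < length ts" for i
    proof -
      have "h i = h (Suc i)" if con: "connects I (ts ! i)"
        using j(2) con by (cases "i = j") (auto simp: h_def)
      then show ?thesis using series.IH[rule_format, OF that] by simp
    qed
    have "\<exists>x. (\<forall>i \<le> length ts. x (vs ! i) = h i) \<and> (\<forall>i < length ts. flat G I (ts ! i) x)"
      by (rule glue_over_series[where P = "\<lambda>i. flat G I (ts ! i)",
            OF series.hyps(1) sub series.hyps(5) _ parts]) (rule flat_local)
    then obtain x where x: "\<forall>i \<le> length ts. x (vs ! i) = h i" "\<forall>i < length ts. flat G I (ts ! i) x"
      by blast
    have "x l = a" "x r = b"
      using x(1)[rule_format, of 0] x(1)[rule_format, of "length ts"] series.hyps(3,4) j(1)
      by (simp_all add: h_def)
    then show ?thesis using x(2) flat_nodes(2) by blast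
  qed
qed

text \<open>The potential is an indicator of a set of vertices that \<open>I\<close> cuts off from the terminals. At a series
  node with two unconnected parts it rises from \<open>0\<close> to \<open>1\<close> inside the first and falls back inside the
  second; at any other node it is inherited from a child and extended by \<open>0\<close>.\<close>

lemma isolated_potential:
  assumes "decomposes G l r t" "\<not> reaches I t"
  shows "\<exists>x. x l = 0 \<and> x r = 0 \<and> flat G I t x \<and> (\<exists>v \<in> node_verts G t. x v \<noteq> 0)"
  using assms
proof (induction rule: decomposes.induct)
  case (edge e l r)
  then show ?case by simp
next
  case (parallel ts l r)
  have dec: "decomposes G l r (Parallel ts)"
    by (rule decomposes.parallel[OF parallel.hyps(1) _ parallel.hyps(2)]) (use parallel.IH in blast)
  obtain p where p: "p < length ts" "\<not> reaches I (ts ! p)"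
    using parallel.prems by (auto simp: in_set_conv_nth)
  define P where "P i x \<longleftrightarrow> flat G I (ts ! i) x \<and> (i = p \<longrightarrow> (\<exists>v \<in> node_verts G (ts ! i). x v \<noteq> 0))"
    for i and x :: "'a \<Rightarrow> real"
  have "\<exists>x. x l = 0 \<and> x r = 0 \<and> (\<forall>i < length ts. P i x)"
  proof (rule glue_over_parallel[OF dec])
    fix i and x y :: "'a \<Rightarrow> real"
    assume "\<forall>v \<in> node_verts G (ts ! i). x v = y v" "P i x"
    then show "P i y" unfolding P_def using flat_local by (metis (no_types, lifting))
  next
    fix i assume i: "i < length ts"
    show "\<exists>x. x l = 0 \<and> x r = 0 \<and> P i x"
    proof (cases "i = p")
      case True
      then show ?thesis using parallel.IH p nth_mem[OF i] by (auto simp: P_def)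
    next
      case False
      then show ?thesis using flat_const[of G I "ts ! i" 0] by (auto simp: P_def)
    qed
  qed
  then show ?case using p(1) unfolding P_def flat_nodes node_verts_as_UN_nth by blast
next
  case (series ts vs l r)
  have sub: "\<forall>i < length ts. decomposes G (vs ! i) (vs ! Suc i) (ts ! i)"
    using series.IH by blast
  have glue: "\<exists>x. (\<forall>i \<le> length ts. x (vs ! i) = h i) \<and> (\<forall>i < length ts. P i x)"
    if "\<And>i x y. i < length ts \<Longrightarrow> \<forall>v \<in> node_verts G (ts ! i). x v = y v \<Longrightarrow> P i x \<Longrightarrow> P i y"
      "\<And>i. i < length ts \<Longrightarrow> \<exists>x. x (vs ! i) = h i \<and> x (vs ! Suc i) = h (Suc i) \<and> P i x"
    for P :: "nat \<Rightarrow> ('a \<Rightarrow> real) \<Rightarrow> bool" and h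
    by (rule glue_over_series[OF series.hyps(1) sub series.hyps(5) that])
  show ?case
  proof (cases "\<forall>t \<in> set ts. reaches I t")
    case False
    then obtain p where p: "p < length ts" "\<not> reaches I (ts ! p)"
      by (auto simp: in_set_conv_nth)
    define P where "P i x \<longleftrightarrow> flat G I (ts ! i) x \<and> (i = p \<longrightarrow> (\<exists>v \<in> node_verts G (ts ! i). x v \<noteq> 0))"
      for i and x :: "'a \<Rightarrow> real"
    have "\<exists>x. (\<forall>i \<le> length ts. x (vs ! i) = 0) \<and> (\<forall>i < length ts. P i x)"
    proof (rule glue)
      fix i and x y :: "'a \<Rightarrow> real"
      assume "\<forall>v \<in> node_verts G (ts ! i). x v = y v" "P i x"
      then show "P i y" unfolding P_def using flat_local by (metis (no_types, lifting))
    next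
      fix i assume i: "i < length ts"
      show "\<exists>x. x (vs ! i) = 0 \<and> x (vs ! Suc i) = 0 \<and> P i x"
      proof (cases "i = p")
        case True
        then show ?thesis using series.IH p by (auto simp: P_def)
      next
        case False
        then show ?thesis using flat_const[of G I "ts ! i" 0] by (auto simp: P_def)
      qed
    qed
    then obtain x where x: "\<forall>i \<le> length ts. x (vs ! i) = 0" "\<forall>i < length ts. P i x" by blast
    then have "x l = 0" "x r = 0" using series.hyps(3,4) by (metis le0, metis order_refl)
    then show ?thesis using x(2) p(1) unfolding P_def flat_nodes node_verts_as_UN_nth by blast
  next
    case True
    then have "\<not> length (filter (\<lambda>t. \<not> connects I t) ts) \<le> 1" using series.prems by simp
    then obtain p q where pq: "q < length ts" "p < q" "\<not> connects I (ts ! q)" "\<not> connects I (ts ! p)"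
      unfolding length_filter_le_1_iff by blast
    \<comment> \<open>Part \<open>i\<close> runs from cut vertex \<open>i\<close> to cut vertex \<open>i + 1\<close>, so \<open>h\<close> changes exactly across \<open>p\<close> and \<open>q\<close>.\<close>
    define h :: "nat \<Rightarrow> real" where "h i = (if p < i \<and> i \<le> q then 1 else 0)" for i
    have "\<exists>x. (\<forall>i \<le> length ts. x (vs ! i) = h i) \<and> (\<forall>i < length ts. flat G I (ts ! i) x)"
    proof (rule glue)
      fix i assume i: "i < length ts"
      have "h i = h (Suc i)" if "connects I (ts ! i)"
      proof -
        have "i \<noteq> p" "i \<noteq> q" using that pq by auto
        then show ?thesis by (auto simp: h_def)
      qed
      then show "\<exists>x. x (vs ! i) = h i \<and> x (vs ! Suc i) = h (Suc i) \<and> flat G I (ts ! i) x"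
        using series.IH i by (intro flat_potential) blast+
    qed (rule flat_local)
    then obtain x where x: "\<forall>i \<le> length ts. x (vs ! i) = h i" "\<forall>i < length ts. flat G I (ts ! i) x"
      by blast
    have "x l = 0" "x r = 0"
      using x(1)[rule_format, of 0] x(1)[rule_format, of "length ts"] series.hyps(3,4) pq(1)
      by (simp_all add: h_def)
    moreover have "x (vs ! q) \<noteq> 0" using x(1) pq by (simp add: h_def)
    moreover have "vs ! q \<in> node_verts G (ts ! q)"
      using series.IH pq(1) by (blast dest: terminals_in_node_verts)
    ultimately show ?thesis using x(2) pq(1) unfolding flat_nodes node_verts_as_UN_nth by blast
  qed
qed

section \<open>Counting the edges of a spanning forest\<close>

lemma finite_node_verts: "finite (node_verts G t)"
  by (simp add: node_verts_def finite_leaves ends_def)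

lemma card_Int_leaves:
  assumes "part_edges_disjoint ts"
  shows "card (I \<inter> leaves (Parallel ts)) = (\<Sum>i<length ts. card (I \<inter> leaves (ts ! i)))"
    and "card (I \<inter> leaves (Series ts)) = (\<Sum>i<length ts. card (I \<inter> leaves (ts ! i)))"
proof -
  have *: "card (I \<inter> A) = (\<Sum>e\<in>A. of_bool (e \<in> I))" if "finite A" for A :: "'a set"
    using that by (simp add: of_bool_def sum.If_cases Int_commute)
  show "card (I \<inter> leaves (Parallel ts)) = (\<Sum>i<length ts. card (I \<inter> leaves (ts ! i)))"
    "card (I \<inter> leaves (Series ts)) = (\<Sum>i<length ts. card (I \<inter> leaves (ts ! i)))"
    unfolding *[OF finite_leaves] by (rule sum_leaves[OF assms])+
qed

lemma sum_of_bool_nth: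
  "(\<Sum>i<length ts. of_bool (P (ts ! i)) :: 'a :: semiring_1) = of_nat (length (filter P ts))"
proof -
  have "{i. i < length ts \<and> P (ts ! i)} = {..<length ts} \<inter> {i. P (ts ! i)}" by auto
  then show ?thesis
    by (simp add: length_filter_conv_card of_bool_def sum.If_cases)
qed

lemma of_bool_ex: "of_bool (\<exists>t \<in> set ts. P t) = min (1::nat) (length (filter P ts))"
  by (induction ts) auto

lemma of_bool_all: "of_bool (\<forall>t \<in> set ts. P t) = 1 - min (1::nat) (length (filter (\<lambda>t. \<not> P t) ts))"
  by (induction ts) auto

text \<open>A set of edges that joins every inner vertex to a terminal has at least as many edges as there are inner
  vertices, one more if it also connects the terminals, and again one more if it contains a cycle. At the
  root of a graph with \<open>k + 1\<close> vertices, a connecting set of \<open>k\<close> edges leaves no room for the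
  last summand.

  In a series composition of \<open>s\<close> parts the \<open>s - 1\<close> cut vertices are new inner vertices. They are paid for
  by the connected parts, of which there are \<open>s\<close> or \<open>s - 1\<close>.\<close>

lemma card_inner_verts_le:
  assumes "decomposes G l r t" "reaches I t"
  shows "card (node_verts G t - {l, r}) + of_bool (connects I t) + of_bool (\<not> cycle_free I t)
    \<le> card (I \<inter> leaves t)"
  using assms
proof (induction rule: decomposes.induct)
  case (edge e l r)
  then have "node_verts G (Leaf e) - {l, r} = {}" by (simp add: node_verts_as_UN_nth)
  then show ?case by (simp only: card.empty) simp
next
  case (parallel ts l r)
  have dis: "part_edges_disjoint ts" using parallel.hyps(2) by (simp add: part_edges_disjoint_def)
  have IH: "card (node_verts G (ts ! i) - {l, r}) + of_bool (connects I (ts ! i))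
    + of_bool (\<not> cycle_free I (ts ! i)) \<le> card (I \<inter> leaves (ts ! i))" if "i < length ts" for i
    using bspec[OF parallel.IH nth_mem[OF that]] parallel.prems that by simp
  have "card (node_verts G (Parallel ts) - {l, r}) \<le> (\<Sum>i<length ts. card (node_verts G (ts ! i) - {l, r}))"
  proof -
    have "node_verts G (Parallel ts) - {l, r} = (\<Union>i<length ts. node_verts G (ts ! i) - {l, r})"
      unfolding node_verts_as_UN_nth by blast
    then show ?thesis by (simp only:) (rule card_UN_le, simp)
  qed
  moreover have "(\<Sum>i<length ts. card (node_verts G (ts ! i) - {l, r}) + of_bool (connects I (ts ! i))
    + of_bool (\<not> cycle_free I (ts ! i))) \<le> card (I \<inter> leaves (Parallel ts))"
    unfolding card_Int_leaves[OF dis] using IH by (intro sum_mono) simp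
  moreover have "of_bool (connects I (Parallel ts)) + of_bool (\<not> cycle_free I (Parallel ts))
    \<le> length (filter (connects I) ts) + length (filter (\<lambda>t. \<not> cycle_free I t) ts)"
  proof -
    have "of_bool (\<not> (\<forall>t\<in>set ts. cycle_free I t)) = min (1::nat) (length (filter (\<lambda>t. \<not> cycle_free I t) ts))"
      using of_bool_ex[of ts "\<lambda>t. \<not> cycle_free I t"] by simp
    then show ?thesis
      using of_bool_ex[of ts "connects I"] by (auto simp: of_bool_def split: if_splits)
  qed
  ultimately show ?case
    unfolding sum.distrib sum_of_bool_nth sum_of_bool_nth[of "\<lambda>t. \<not> cycle_free I t"] of_nat_id
    by linarith
next
  case (series ts vs l r)
  have dis: "part_edges_disjoint ts" using series.hyps(5) by (simp add: part_edges_disjoint_def)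
  have IH: "card (node_verts G (ts ! i) - {vs ! i, vs ! Suc i}) + of_bool (connects I (ts ! i))
    + of_bool (\<not> cycle_free I (ts ! i)) \<le> card (I \<inter> leaves (ts ! i))" if "i < length ts" for i
    using series.IH[rule_format, OF that] series.prems nth_mem[OF that] by simp
  have "node_verts G (Series ts) - {l, r} \<subseteq>
      (\<Union>i<length ts. node_verts G (ts ! i) - {vs ! i, vs ! Suc i}) \<union> (\<lambda>i. vs ! i) ` {1..<length ts}"
  proof
    fix v assume v: "v \<in> node_verts G (Series ts) - {l, r}"
    then obtain i where i: "i < length ts" "v \<in> node_verts G (ts ! i)"
      unfolding node_verts_as_UN_nth by blast
    have "v = vs ! k \<Longrightarrow> k \<noteq> 0 \<and> k \<noteq> length ts" for k
      using v series.hyps(3,4) by (metis Diff_iff insert_iff)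
    then have "v = vs ! k \<Longrightarrow> k \<le> length ts \<Longrightarrow> v \<in> (\<lambda>i. vs ! i) ` {1..<length ts}" for k
      by (metis One_nat_def atLeastLessThan_iff imageI le_neq_implies_less Suc_leI neq0_conv)
    from this[of i] this[of "Suc i"]
    show "v \<in> (\<Union>i<length ts. node_verts G (ts ! i) - {vs ! i, vs ! Suc i}) \<union> (\<lambda>i. vs ! i) ` {1..<length ts}"
      using i by auto
  qed
  then have "card (node_verts G (Series ts) - {l, r}) \<le>
      card ((\<Union>i<length ts. node_verts G (ts ! i) - {vs ! i, vs ! Suc i}) \<union> (\<lambda>i. vs ! i) ` {1..<length ts})"
    by (intro card_mono) (auto simp: finite_node_verts)
  also have "\<dots> \<le> card (\<Union>i<length ts. node_verts G (ts ! i) - {vs ! i, vs ! Suc i}) + card ((\<lambda>i. vs ! i) ` {1..<length ts})"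
    by (rule card_Un_le)
  also have "\<dots> \<le> (\<Sum>i<length ts. card (node_verts G (ts ! i) - {vs ! i, vs ! Suc i})) + (length ts - 1)"
    using card_UN_le[of "{..<length ts}" "\<lambda>i. node_verts G (ts ! i) - {vs ! i, vs ! Suc i}"]
      card_image_le[of "{1..<length ts}" "\<lambda>i. vs ! i"] by (intro add_mono) simp_all
  finally have inner: "card (node_verts G (Series ts) - {l, r}) \<le>
    (\<Sum>i<length ts. card (node_verts G (ts ! i) - {vs ! i, vs ! Suc i})) + (length ts - 1)" .
  have "(\<Sum>i<length ts. card (node_verts G (ts ! i) - {vs ! i, vs ! Suc i}) + of_bool (connects I (ts ! i))
    + of_bool (\<not> cycle_free I (ts ! i))) \<le> card (I \<inter> leaves (Series ts))"
    unfolding card_Int_leaves[OF dis] using IH by (intro sum_mono) simp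
  moreover have "length ts - 1 + of_bool (connects I (Series ts)) + of_bool (\<not> cycle_free I (Series ts))
    \<le> length (filter (connects I) ts) + length (filter (\<lambda>t. \<not> cycle_free I t) ts)"
  proof -
    have "of_bool (\<not> cycle_free I (Series ts)) = min (1::nat) (length (filter (\<lambda>t. \<not> cycle_free I t) ts))"
      using of_bool_ex[of ts "\<lambda>t. \<not> cycle_free I t"] by simp
    moreover have "of_bool (connects I (Series ts)) = 1 - min (1::nat) (length (filter (\<lambda>t. \<not> connects I t) ts))"
      using of_bool_all[of ts "connects I"] by simp
    moreover have "length (filter (connects I) ts) + length (filter (\<lambda>t. \<not> connects I t) ts) = length ts"
      by (rule sum_length_filter_compl)
    moreover have "length (filter (\<lambda>t. \<not> connects I t) ts) \<le> 1" using series.prems by simp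
    moreover have "0 < length ts" using series.hyps(1) by simp
    ultimately show ?thesis by linarith
  qed
  ultimately show ?case using inner
    unfolding sum.distrib sum_of_bool_nth sum_of_bool_nth[of "\<lambda>t. \<not> cycle_free I t"] of_nat_id
    by linarith
qed

section \<open>Energy and its reduction to the terminals\<close>

text \<open>The part of the graph-induced weight that is contributed by the chain below a node. The factor
  at a series node pairs it with its child on the chain; parallel nodes contribute nothing of their own.
  The lists have one entry if the parts are disjoint and contain the edge.\<close>

fun node_weight :: "nat \<Rightarrow> 'e sp_tree \<Rightarrow> 'e \<Rightarrow> real" where
  "node_weight n (Leaf f) e = 1"
| "node_weight n (Series ts) e = sum_list (concat (map (\<lambda>t. if e \<in> leaves t
     then [phi n (card (leaves (Series ts))) / phi n (card (leaves t)) * node_weight n t e] else []) ts))"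
| "node_weight n (Parallel ts) e = sum_list (concat (map (\<lambda>t. if e \<in> leaves t
     then [node_weight n t e] else []) ts))"

lemma node_weight_part:
  assumes "part_edges_disjoint ts" "i < length ts" "e \<in> leaves (ts ! i)"
  shows "node_weight n (Parallel ts) e = node_weight n (ts ! i) e"
    and "node_weight n (Series ts) e =
      phi n (card (leaves (Series ts))) / phi n (card (leaves (ts ! i))) * node_weight n (ts ! i) e"
  unfolding node_weight.simps concat_map_unique_part[OF assms] by simp_all

text \<open>Positive where more than the fraction \<open>1 / n\<close> of the energy of \<open>x\<close> is carried by the edges in \<open>I\<close>.\<close>

definition energy :: "('v, 'e) pre_digraph \<Rightarrow> nat \<Rightarrow> 'e set \<Rightarrow> 'e sp_tree \<Rightarrow> ('v \<Rightarrow> real) \<Rightarrow> real" where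
  "energy G n I t x =
     (\<Sum>e \<in> leaves t. (real n * of_bool (e \<in> I) - 1) * node_weight n t e * (edge_diff G x e)\<^sup>2)"

lemma energy_parts:
  assumes "part_edges_disjoint ts"
  shows "energy G n I (Parallel ts) x = (\<Sum>i<length ts. energy G n I (ts ! i) x)"
    and "energy G n I (Series ts) x = (\<Sum>i<length ts.
      phi n (card (leaves (Series ts))) / phi n (card (leaves (ts ! i))) * energy G n I (ts ! i) x)"
  unfolding energy_def sum_leaves[OF assms] sum_distrib_left
  by (intro sum.cong refl; use node_weight_part[OF assms] in simp)+

lemma energy_local:
  assumes "\<forall>v \<in> node_verts G t. x v = y v"
  shows "energy G n I t x = energy G n I t y"
  unfolding energy_def using edge_diff_cong_node[of G t x y] assms by (intro sum.cong) auto

text \<open>Eliminating all vertices but \<open>l\<close> and \<open>r\<close> from \<open>F\<close> leaves a single edge of conductance \<open>c\<close>, and the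
  minimum is attained. For positive definite networks \<open>c\<close> is the effective conductance; here \<open>c\<close> may be
  negative.\<close>

definition reduces_to :: "(('v \<Rightarrow> real) \<Rightarrow> real) \<Rightarrow> 'v \<Rightarrow> 'v \<Rightarrow> real \<Rightarrow> bool" where
  "reduces_to F l r c \<longleftrightarrow> (\<forall>x. c * (x r - x l)\<^sup>2 \<le> F x) \<and>
     (\<forall>a b. \<exists>x. x l = a \<and> x r = b \<and> F x = c * (b - a)\<^sup>2)"

definition conductance :: "nat \<Rightarrow> 'e set \<Rightarrow> 'e sp_tree \<Rightarrow> real" where
  "conductance n I t = real n * of_bool (connects I t) - real (card (leaves t))"

text \<open>Conductances in parallel add up. As the number of connected parts is \<open>0\<close> or \<open>1\<close>, the sum has the form
  required of the whole node. The node may have all \<open>n\<close> edges, so this lemma also covers the root.\<close>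

lemma energy_reduces_parallel:
  assumes dec: "decomposes G l r (Parallel ts)"
    and parts: "\<And>i. i < length ts \<Longrightarrow> reduces_to (energy G n I (ts ! i)) l r (conductance n I (ts ! i))"
    and one: "length (filter (connects I) ts) \<le> 1"
  shows "reduces_to (energy G n I (Parallel ts)) l r (conductance n I (Parallel ts))"
proof -
  have dis: "part_edges_disjoint ts" using dec by (rule decomposes_part_edges_disjoint)
  have "of_bool (connects I (Parallel ts)) = real (length (filter (connects I) ts))"
  proof -
    have "of_bool (connects I (Parallel ts)) = length (filter (connects I) ts)"
      using of_bool_ex[of ts "connects I"] one by simp
    then show ?thesis by (metis of_nat_of_bool)
  qed
  then have c: "conductance n I (Parallel ts) = (\<Sum>i<length ts. conductance n I (ts ! i))"
    by (simp add: conductance_def card_leaves[OF dis] sum_subtractf sum_distrib_left[symmetric]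
        sum_of_bool_nth del: connects.simps sp_tree.set)
  have "conductance n I (Parallel ts) * (x r - x l)\<^sup>2 \<le> energy G n I (Parallel ts) x" for x
    unfolding c energy_parts[OF dis] sum_distrib_right
    using parts by (intro sum_mono) (simp add: reduces_to_def)
  moreover have "\<exists>x. x l = a \<and> x r = b \<and>
      energy G n I (Parallel ts) x = conductance n I (Parallel ts) * (b - a)\<^sup>2" for a b
  proof -
    have "\<exists>x. x l = a \<and> x r = b \<and>
      (\<forall>i < length ts. energy G n I (ts ! i) x = conductance n I (ts ! i) * (b - a)\<^sup>2)"
    proof (rule glue_over_parallel[OF dec])
      fix i and x y :: "'a \<Rightarrow> real"
      assume "\<forall>v\<in>node_verts G (ts ! i). x v = y v"
        "energy G n I (ts ! i) x = conductance n I (ts ! i) * (b - a)\<^sup>2"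
      then show "energy G n I (ts ! i) y = conductance n I (ts ! i) * (b - a)\<^sup>2"
        using energy_local by metis
    next
      fix i assume "i < length ts"
      from parts[OF this] show "\<exists>x. x l = a \<and> x r = b \<and>
          energy G n I (ts ! i) x = conductance n I (ts ! i) * (b - a)\<^sup>2"
        unfolding reduces_to_def by blast
    qed
    then obtain x where "x l = a" "x r = b"
      "\<forall>i < length ts. energy G n I (ts ! i) x = conductance n I (ts ! i) * (b - a)\<^sup>2" by blast
    then show ?thesis unfolding c energy_parts[OF dis] sum_distrib_right
      by (intro exI[of _ x]) simp
  qed
  ultimately show ?thesis unfolding reduces_to_def by blast
qed

lemma weighted_cauchy_schwarz:
  fixes u m :: "'i \<Rightarrow> real"
  assumes "\<And>i. i \<in> A \<Longrightarrow> 0 < m i"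
  shows "(\<Sum>i\<in>A. u i)\<^sup>2 \<le> (\<Sum>i\<in>A. m i) * (\<Sum>i\<in>A. (u i)\<^sup>2 / m i)"
proof -
  have "m i \<noteq> 0" if "i \<in> A" for i using assms[OF that] by simp
  then have "(\<Sum>i\<in>A. u i) = (\<Sum>i\<in>A. sqrt (m i) * (u i / sqrt (m i)))"
    by (intro sum.cong) auto
  moreover have "(\<Sum>i\<in>A. (sqrt (m i))\<^sup>2) = (\<Sum>i\<in>A. m i)"
    using assms by (intro sum.cong) (auto intro: less_imp_le)
  moreover have "(\<Sum>i\<in>A. (u i / sqrt (m i))\<^sup>2) = (\<Sum>i\<in>A. (u i)\<^sup>2 / m i)"
    using assms by (intro sum.cong) (auto simp: power_divide intro: less_imp_le)
  ultimately show ?thesis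
    using Cauchy_Schwarz_ineq_sum[of "\<lambda>i. sqrt (m i)" "\<lambda>i. u i / sqrt (m i)" A] by simp
qed

text \<open>Conductances \<open>M * p / m\<^sub>i\<close> in series have the resulting conductance \<open>p\<close>, because their inverses sum to
  \<open>1 / p\<close>. The potential drop splits in proportion to the resistances \<open>m\<^sub>i\<close>.\<close>

lemma series_form_connected:
  fixes m :: "'i \<Rightarrow> real"
  assumes fin: "finite A" and pos: "\<And>i. i \<in> A \<Longrightarrow> 0 < m i" and A: "A \<noteq> {}" and p: "0 < p"
    and M: "M = (\<Sum>i\<in>A. m i)"
  shows "p * (\<Sum>i\<in>A. s i)\<^sup>2 \<le> (\<Sum>i\<in>A. M * p / m i * (s i)\<^sup>2)"
    and "\<exists>s. (\<Sum>i\<in>A. s i) = 1 \<and> (\<Sum>i\<in>A. M * p / m i * (s i)\<^sup>2) = p"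
proof -
  have Mpos: "0 < M" unfolding M using fin A pos by (intro sum_pos) auto
  have "p * (\<Sum>i\<in>A. s i)\<^sup>2 \<le> p * (M * (\<Sum>i\<in>A. (s i)\<^sup>2 / m i))"
    unfolding M using p weighted_cauchy_schwarz[OF pos] by (intro mult_left_mono) auto
  also have "\<dots> = (\<Sum>i\<in>A. M * p / m i * (s i)\<^sup>2)"
    by (simp add: sum_distrib_left mult_ac)
  finally show "p * (\<Sum>i\<in>A. s i)\<^sup>2 \<le> (\<Sum>i\<in>A. M * p / m i * (s i)\<^sup>2)" .
  have "(\<Sum>i\<in>A. M * p / m i * (m i / M)\<^sup>2) = (\<Sum>i\<in>A. p / M * m i)"
    using pos Mpos by (intro sum.cong) (auto simp: field_simps power2_eq_square dest: less_imp_neq)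
  also have "\<dots> = p" unfolding sum_distrib_left[symmetric] M[symmetric] using Mpos by simp
  finally show "\<exists>s. (\<Sum>i\<in>A. s i) = 1 \<and> (\<Sum>i\<in>A. M * p / m i * (s i)\<^sup>2) = p"
    using Mpos by (intro exI[of _ "\<lambda>i. m i / M"]) (simp add: sum_divide_distrib[symmetric] M[symmetric])
qed

text \<open>With one negative conductance at \<open>j\<close> the form in the drops \<open>s\<close> is not positive, but it is still bounded
  below once the total drop \<open>S\<close> is fixed. The drop at \<open>j\<close> is \<open>S\<close> minus the other drops, and the
  Cauchy-Schwarz inequality is applied to this sum, with weight \<open>p\<close> for the summand \<open>S\<close>; the
  weights then sum to \<open>p + M - m\<^sub>j\<close>, which is the denominator at \<open>j\<close>. The minimiser has drops
  against the direction of the total drop at every part except \<open>j\<close>.\<close>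

lemma series_form_separated:
  fixes m :: "'i \<Rightarrow> real"
  assumes fin: "finite A" and pos: "\<And>i. i \<in> A \<Longrightarrow> 0 < m i" and j: "j \<in> A" and p: "0 < p"
    and M: "M = (\<Sum>i\<in>A. m i)"
    and c: "\<And>i. i \<in> A \<Longrightarrow> c i = (if i = j then - (M * p / (p + M - m j)) else M * p / m i)"
  shows "- M * (\<Sum>i\<in>A. s i)\<^sup>2 \<le> (\<Sum>i\<in>A. c i * (s i)\<^sup>2)"
    and "\<exists>s. (\<Sum>i\<in>A. s i) = 1 \<and> (\<Sum>i\<in>A. c i * (s i)\<^sup>2) = - M"
proof -
  define R where "R = A - {j}"
  have split: "sum f A = f j + sum f R" for f :: "'i \<Rightarrow> real"
    unfolding R_def using fin j by (rule sum.remove)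
  have cR: "sum (\<lambda>i. c i * f i) R = M * p * (\<Sum>i\<in>R. f i / m i)" for f :: "'i \<Rightarrow> real"
    unfolding sum_distrib_left using c by (intro sum.cong) (auto simp: R_def)
  have cj: "c j = - (M * p / (p + M - m j))" using c j by simp
  have MR: "M - m j = sum m R" unfolding M split[of m] by simp
  have R0: "0 \<le> sum m R" using pos by (intro sum_nonneg) (auto simp: R_def less_imp_le)
  define q where "q = p + M - m j"
  have q: "q = p + sum m R" "0 < q" using MR R0 p by (auto simp: q_def)
  have Mpos: "0 < M" unfolding M using fin j pos by (intro sum_pos) auto
  show "- M * (\<Sum>i\<in>A. s i)\<^sup>2 \<le> (\<Sum>i\<in>A. c i * (s i)\<^sup>2)"
  proof -
    define S where "S = (\<Sum>i\<in>A. s i)"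
    define u where "u i = (if i = j then S else - s i)" for i
    define \<mu> where "\<mu> i = (if i = j then p else m i)" for i
    have uR: "sum u R = - sum s R" "sum \<mu> R = sum m R"
      "(\<Sum>i\<in>R. (u i)\<^sup>2 / \<mu> i) = (\<Sum>i\<in>R. (s i)\<^sup>2 / m i)"
      unfolding sum_negf[symmetric] by (intro sum.cong; auto simp: u_def \<mu>_def R_def)+
    have "(\<Sum>i\<in>A. u i)\<^sup>2 \<le> (\<Sum>i\<in>A. \<mu> i) * (\<Sum>i\<in>A. (u i)\<^sup>2 / \<mu> i)"
      using pos p by (intro weighted_cauchy_schwarz) (simp add: \<mu>_def)
    moreover have "(\<Sum>i\<in>A. u i) = s j"
      unfolding split[of u] uR using split[of s] by (simp add: u_def S_def)
    moreover have "(\<Sum>i\<in>A. \<mu> i) = q"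
      unfolding split[of \<mu>] uR q by (simp add: \<mu>_def)
    moreover have "(\<Sum>i\<in>A. (u i)\<^sup>2 / \<mu> i) = S\<^sup>2 / p + (\<Sum>i\<in>R. (s i)\<^sup>2 / m i)"
      unfolding split[of "\<lambda>i. (u i)\<^sup>2 / \<mu> i"] uR by (simp add: u_def \<mu>_def)
    ultimately have "(s j)\<^sup>2 \<le> q * (S\<^sup>2 / p + (\<Sum>i\<in>R. (s i)\<^sup>2 / m i))" by simp
    then have "M * p / q * (s j)\<^sup>2 \<le> M * p / q * (q * (S\<^sup>2 / p + (\<Sum>i\<in>R. (s i)\<^sup>2 / m i)))"
      using Mpos p q by (intro mult_left_mono) auto
    also have "\<dots> = M * S\<^sup>2 + M * p * (\<Sum>i\<in>R. (s i)\<^sup>2 / m i)"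
      using p q(2) by (simp add: field_simps)
    finally show ?thesis
      unfolding split[of "\<lambda>i. c i * (s i)\<^sup>2"] cR cj S_def[symmetric] q_def[symmetric] by simp
  qed
  define s where "s i = (if i = j then q / p else - m i / p)" for i
  have sR: "sum s R = - (sum m R / p)" "(\<Sum>i\<in>R. (s i)\<^sup>2 / m i) = sum m R / p\<^sup>2"
    unfolding sum_negf[symmetric] sum_divide_distrib
    using pos by (intro sum.cong; force simp: s_def R_def power2_eq_square field_simps)+
  have "(\<Sum>i\<in>A. s i) = 1"
    unfolding split[of s] sR using p by (simp add: s_def q(1) field_simps)
  moreover have "(\<Sum>i\<in>A. c i * (s i)\<^sup>2) = - M"
  proof -
    have "(\<Sum>i\<in>A. c i * (s i)\<^sup>2) = M * p * (sum m R / p\<^sup>2) - M * p / q * (q / p)\<^sup>2"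
      unfolding split[of "\<lambda>i. c i * (s i)\<^sup>2"] cR cj sR q_def[symmetric] by (simp add: s_def)
    also have "\<dots> = M / p * (sum m R - q)"
      using p q(2) by (simp add: field_simps power2_eq_square)
    also have "\<dots> = - M" using p by (simp add: q(1))
    finally show ?thesis .
  qed
  ultimately show "\<exists>s. (\<Sum>i\<in>A. s i) = 1 \<and> (\<Sum>i\<in>A. c i * (s i)\<^sup>2) = - M" by blast
qed

lemma card_leaves_pos: "decomposes G l r t \<Longrightarrow> 0 < card (leaves t)"
  using terminals_in_node_verts[of G l r t] finite_leaves[of t]
  by (auto simp: node_verts_def card_gt_0_iff)

lemma card_leaves_nth_le:
  assumes "i < length ts"
  shows "card (leaves (ts ! i)) \<le> card (leaves (Series ts))"
    and "card (leaves (ts ! i)) \<le> card (leaves (Parallel ts))"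
  using assms unfolding leaves_as_UN_nth by (intro card_mono; auto simp: finite_leaves)+

text \<open>The energy of the parts is minimised for fixed potentials at the cut vertices, which leaves the
  problem in the potential drops that the two preceding lemmas solve. The strict bound on the number \<open>m\<close>
  of edges keeps the factors \<open>\<phi> m\<close> and \<open>\<phi> m\<^sub>i\<close> positive.\<close>

lemma energy_reduces_series:
  fixes G :: "('v, 'e) pre_digraph"
  assumes ne: "ts \<noteq> []"
    and sub: "\<forall>i < length ts. decomposes G (vs ! i) (vs ! Suc i) (ts ! i)"
    and meet: "\<forall>i < length ts. \<forall>j < i. leaves (ts ! i) \<inter> leaves (ts ! j) = {} \<and>
         node_verts G (ts ! i) \<inter> node_verts G (ts ! j) = (if i = Suc j then {vs ! i} else {})"
    and parts: "\<And>i. i < length ts \<Longrightarrow>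
      reduces_to (energy G n I (ts ! i)) (vs ! i) (vs ! Suc i) (conductance n I (ts ! i))"
    and one: "length (filter (\<lambda>t. \<not> connects I t) ts) \<le> 1"
    and n: "card (leaves (Series ts)) < n"
  shows "reduces_to (energy G n I (Series ts)) (vs ! 0) (vs ! length ts) (conductance n I (Series ts))"
proof -
  have dis: "part_edges_disjoint ts" using meet by (simp add: part_edges_disjoint_def)
  define m where "m i = real (card (leaves (ts ! i)))" for i
  define M where "M = real (card (leaves (Series ts)))"
  define p where "p = real n - M"
  define k where "k i = phi n (card (leaves (Series ts))) / phi n (card (leaves (ts ! i)))" for i
  define C where "C = conductance n I (Series ts)"
  have p: "0 < p" using n by (simp add: p_def M_def del: sp_tree.set)
  have M: "M = (\<Sum>i<length ts. m i)"
    unfolding M_def m_def card_leaves[OF dis] by simp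
  have m: "0 < m i" "m i \<le> M" if "i < length ts" for i
    using sub that card_leaves_pos[of G "vs ! i" "vs ! Suc i" "ts ! i"] card_leaves_nth_le(1)[OF that]
    by (simp_all add: m_def M_def del: sp_tree.set)
  have k: "k i = M * p / (m i * (p + M - m i))" for i
    by (simp add: k_def phi_def m_def M_def p_def del: sp_tree.set)
  have k0: "0 \<le> k i" if "i < length ts" for i
    unfolding k using m[OF that] p by (intro divide_nonneg_nonneg mult_nonneg_nonneg) auto
  have c: "k i * conductance n I (ts ! i) =
      (if connects I (ts ! i) then M * p / m i else - (M * p / (p + M - m i)))" if "i < length ts" for i
  proof -
    have "conductance n I (ts ! i) = (if connects I (ts ! i) then p + M - m i else - m i)"
      by (simp add: conductance_def p_def m_def)
    then show ?thesis unfolding k using m[OF that] p by simp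
  qed
  have form: "(\<forall>s. C * (\<Sum>i<length ts. s i)\<^sup>2 \<le> (\<Sum>i<length ts. k i * conductance n I (ts ! i) * (s i)\<^sup>2)) \<and>
    (\<exists>s. (\<Sum>i<length ts. s i) = 1 \<and> (\<Sum>i<length ts. k i * conductance n I (ts ! i) * (s i)\<^sup>2) = C)"
  proof (cases "connects I (Series ts)")
    case True
    then have C: "C = p" by (simp add: C_def conductance_def p_def M_def)
    have eq: "(\<Sum>i<length ts. k i * conductance n I (ts ! i) * (s i)\<^sup>2) =
      (\<Sum>i<length ts. M * p / m i * (s i)\<^sup>2)" for s
      using c True by (intro sum.cong) auto
    show ?thesis unfolding eq C
      using series_form_connected[of "{..<length ts}" m p M] m(1) ne p M by auto
  next
    case False
    then obtain j where j: "j < length ts" "\<not> connects I (ts ! j)"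
      by (auto simp: in_set_conv_nth)
    have C: "C = - M" using False unfolding C_def conductance_def M_def by simp
    have "connects I (ts ! i)" if "i < length ts" "i \<noteq> j" for i
      using one j that unfolding length_filter_le_1_iff by (metis nat_neq_iff)
    then have "k i * conductance n I (ts ! i) = (if i = j then - (M * p / (p + M - m j)) else M * p / m i)"
      if "i < length ts" for i
      using c that j by simp
    then show ?thesis unfolding C
      using series_form_separated[of "{..<length ts}" m j p M "\<lambda>i. k i * conductance n I (ts ! i)"]
        m(1) j p M by auto
  qed
  have energy: "energy G n I (Series ts) x = (\<Sum>i<length ts. k i * energy G n I (ts ! i) x)" for x
    unfolding energy_parts[OF dis] k_def ..
  have "C * (x (vs ! length ts) - x (vs ! 0))\<^sup>2 \<le> energy G n I (Series ts) x" for x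
  proof -
    have "C * (x (vs ! length ts) - x (vs ! 0))\<^sup>2 = C * (\<Sum>i<length ts. x (vs ! Suc i) - x (vs ! i))\<^sup>2"
      using sum_lessThan_telescope[of "\<lambda>i. x (vs ! i)" "length ts"] by simp
    also have "\<dots> \<le> (\<Sum>i<length ts. k i * conductance n I (ts ! i) * (x (vs ! Suc i) - x (vs ! i))\<^sup>2)"
      using form by blast
    also have "\<dots> \<le> (\<Sum>i<length ts. k i * energy G n I (ts ! i) x)"
    proof (intro sum_mono)
      fix i assume "i \<in> {..<length ts}"
      then have i: "i < length ts" by simp
      from parts[OF i] have "conductance n I (ts ! i) * (x (vs ! Suc i) - x (vs ! i))\<^sup>2 \<le> energy G n I (ts ! i) x"
        unfolding reduces_to_def by blast
      then show "k i * conductance n I (ts ! i) * (x (vs ! Suc i) - x (vs ! i))\<^sup>2 \<le> k i * energy G n I (ts ! i) x"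
        using k0[OF i] mult_left_mono by (metis mult.assoc)
    qed
    finally show ?thesis unfolding energy .
  qed
  moreover have "\<exists>x. x (vs ! 0) = a \<and> x (vs ! length ts) = b \<and>
      energy G n I (Series ts) x = C * (b - a)\<^sup>2" for a b
  proof -
    obtain s where s: "(\<Sum>i<length ts. s i) = 1"
      "(\<Sum>i<length ts. k i * conductance n I (ts ! i) * (s i)\<^sup>2) = C" using form by blast
    define h where "h i = a + (b - a) * (\<Sum>j<i. s j)" for i
    have h: "h (Suc i) - h i = (b - a) * s i" for i by (simp add: h_def algebra_simps)
    define P where "P i x \<longleftrightarrow> energy G n I (ts ! i) x = conductance n I (ts ! i) * (h (Suc i) - h i)\<^sup>2"
      for i and x :: "'v \<Rightarrow> real"
    have "\<exists>x. (\<forall>i \<le> length ts. x (vs ! i) = h i) \<and> (\<forall>i < length ts. P i x)"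
    proof (rule glue_over_series[OF ne sub meet])
      fix i and x y :: "'v \<Rightarrow> real"
      assume "\<forall>v\<in>node_verts G (ts ! i). x v = y v" "P i x"
      then show "P i y" unfolding P_def using energy_local by metis
    next
      fix i assume "i < length ts"
      from parts[OF this] show "\<exists>x. x (vs ! i) = h i \<and> x (vs ! Suc i) = h (Suc i) \<and> P i x"
        unfolding reduces_to_def P_def by blast
    qed
    then obtain x where x: "\<forall>i \<le> length ts. x (vs ! i) = h i" "\<forall>i < length ts. P i x" by blast
    have "energy G n I (Series ts) x = (\<Sum>i<length ts. (b - a)\<^sup>2 * (k i * conductance n I (ts ! i) * (s i)\<^sup>2))"
      unfolding energy using x(2) by (intro sum.cong) (auto simp: P_def h power_mult_distrib)
    also have "\<dots> = C * (b - a)\<^sup>2" unfolding sum_distrib_left[symmetric] s(2) by simp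
    finally have "energy G n I (Series ts) x = C * (b - a)\<^sup>2" .
    moreover have "x (vs ! 0) = a" "x (vs ! length ts) = b" using x(1) s(1) by (simp_all add: h_def)
    ultimately show ?thesis by blast
  qed
  ultimately show ?thesis unfolding reduces_to_def C_def by blast
qed

lemma energy_reduces:
  assumes "decomposes G l r t" "reaches I t" "cycle_free I t" "card (leaves t) < n"
  shows "reduces_to (energy G n I t) l r (conductance n I t)"
  using assms
proof (induction rule: decomposes.induct)
  case (edge e l r)
  have "energy G n I (Leaf e) x = conductance n I (Leaf e) * (x r - x l)\<^sup>2" for x
    using ends_sq_diff[OF edge.hyps(3), of x] by (simp add: energy_def conductance_def)
  moreover have "\<exists>x. x l = a \<and> x r = b" for a b :: real
    using edge.hyps(2) by (intro exI[of _ "\<lambda>v. if v = l then a else b"]) simp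
  ultimately show ?case unfolding reduces_to_def by (metis order_refl)
next
  case (parallel ts l r)
  have dec: "decomposes G l r (Parallel ts)"
    by (rule decomposes.parallel[OF parallel.hyps(1) _ parallel.hyps(2)]) (use parallel.IH in blast)
  show ?case
  proof (rule energy_reduces_parallel[OF dec])
    fix i assume i: "i < length ts"
    then have "ts ! i \<in> set ts" by simp
    moreover have "card (leaves (ts ! i)) < n"
      using card_leaves_nth_le(2)[OF i] parallel.prems(3) by linarith
    ultimately show "reduces_to (energy G n I (ts ! i)) l r (conductance n I (ts ! i))"
      using bspec[OF parallel.IH, of "ts ! i"] parallel.prems(1,2) by simp
  qed (use parallel.prems(2) in simp)
next
  case (series ts vs l r)
  have sub: "\<forall>i < length ts. decomposes G (vs ! i) (vs ! Suc i) (ts ! i)"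
    using series.IH by blast
  have "reduces_to (energy G n I (Series ts)) (vs ! 0) (vs ! length ts) (conductance n I (Series ts))"
  proof (rule energy_reduces_series[OF series.hyps(1) sub series.hyps(5)])
    fix i assume i: "i < length ts"
    then have "ts ! i \<in> set ts" by simp
    moreover have "card (leaves (ts ! i)) < n"
      using card_leaves_nth_le(1)[OF i] series.prems(3) by linarith
    ultimately show "reduces_to (energy G n I (ts ! i)) (vs ! i) (vs ! Suc i) (conductance n I (ts ! i))"
      using series.IH[rule_format, OF i] series.prems(1,2) by simp
  qed (use series.prems in simp_all)
  then show ?case unfolding series.hyps(3,4) .
qed

lemma node_weight_pos:
  assumes "decomposes G l r t" "e \<in> leaves t" "card (leaves t) < n"
  shows "0 < node_weight n t e"
  using assms
proof (induction rule: decomposes.induct)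
  case (edge f l r)
  then show ?case by simp
next
  case (parallel ts l r)
  have dis: "part_edges_disjoint ts" using parallel.hyps(2) by (simp add: part_edges_disjoint_def)
  obtain i where i: "i < length ts" "e \<in> leaves (ts ! i)"
    using parallel.prems(1) unfolding leaves_as_UN_nth by blast
  have "card (leaves (ts ! i)) < n"
    using card_leaves_nth_le(2)[OF i(1)] parallel.prems(2) by linarith
  then show ?case
    using bspec[OF parallel.IH, of "ts ! i"] i unfolding node_weight_part[OF dis i] by simp
next
  case (series ts vs l r)
  have dis: "part_edges_disjoint ts" using series.hyps(5) by (simp add: part_edges_disjoint_def)
  obtain i where i: "i < length ts" "e \<in> leaves (ts ! i)"
    using series.prems(1) unfolding leaves_as_UN_nth by blast
  have le: "card (leaves (ts ! i)) \<le> card (leaves (Series ts))" "card (leaves (Series ts)) < n"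
    using card_leaves_nth_le(1)[OF i(1)] series.prems(2) by blast+
  moreover have "0 < card (leaves (ts ! i))" using i(2) finite_leaves by (auto simp: card_gt_0_iff)
  ultimately have "0 < phi n (card (leaves (Series ts))) / phi n (card (leaves (ts ! i)))"
    unfolding phi_def by (intro divide_pos_pos mult_pos_pos) linarith+
  moreover have "0 < node_weight n (ts ! i) e"
    using series.IH[rule_format, OF i(1)] i le by simp
  ultimately show ?case unfolding node_weight_part[OF dis i] by (rule mult_pos_pos)
qed

section \<open>Identification of the graph-induced weights\<close>

text \<open>The product that defines the graph-induced weight, for an arbitrary list in place of the chain.\<close>

definition pair_product :: "nat \<Rightarrow> 'e sp_tree list \<Rightarrow> real" where
  "pair_product n cs = (\<Prod>j = 1..(length cs - 1) div 2.
     phi n (card (leaves (cs ! (2 * j - 1)))) / phi n (card (leaves (cs ! (2 * j)))))"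

lemma pair_product_Cons2:
  fixes cs :: "'e sp_tree list"
  assumes "cs \<noteq> []"
  shows "pair_product n (a # b # cs) =
    phi n (card (leaves b)) / phi n (card (leaves (hd cs))) * pair_product n cs"
proof -
  define f where "f = (\<lambda>(cs :: 'e sp_tree list) j. phi n (card (leaves (cs ! (2 * j - 1)))) / phi n (card (leaves (cs ! (2 * j)))) :: real)"
  define d where "d = (length cs - 1) div 2"
  have d: "(length (a # b # cs) - 1) div 2 = Suc d"
    using assms by (cases cs) (simp_all add: d_def)
  have "pair_product n (a # b # cs) = (\<Prod>j = 1..Suc d. f (a # b # cs) j)"
    unfolding pair_product_def d f_def ..
  also have "\<dots> = f (a # b # cs) 1 * (\<Prod>j = Suc 1..Suc d. f (a # b # cs) j)"
    by (rule prod.atLeast_Suc_atMost) simp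
  also have "(\<Prod>j = Suc 1..Suc d. f (a # b # cs) j) = (\<Prod>j = 1..d. f (a # b # cs) (Suc j))"
    by (rule prod.shift_bounds_cl_Suc_ivl)
  also have "\<dots> = (\<Prod>j = 1..d. f cs j)"
  proof (intro prod.cong refl)
    fix j assume "j \<in> {1..d}"
    then obtain q where "j = Suc q" by (cases j) auto
    then show "f (a # b # cs) (Suc j) = f cs j" by (simp add: f_def)
  qed
  finally show ?thesis
    using assms by (simp add: f_def pair_product_def d_def hd_conv_nth)
qed

lemma chain_nonempty: "chain t e \<noteq> []" "hd (chain t e) = t"
  by (cases t; simp)+

lemma chain_part:
  assumes "part_edges_disjoint ts" "i < length ts" "e \<in> leaves (ts ! i)"
  shows "chain (Parallel ts) e = Parallel ts # chain (ts ! i) e"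
    and "chain (Series ts) e = Series ts # chain (ts ! i) e"
  unfolding chain.simps concat_map_unique_part[OF assms] by simp_all

text \<open>Along a chain with alternating types, the entries with odd index are series nodes and those with even
  index their children. Two levels of the tree are removed in each step.\<close>

lemma pair_product_chain:
  assumes "decomposes G l r t" "alternating_par t \<or> (\<exists>f. t = Leaf f)" "e \<in> leaves t"
  shows "pair_product n (chain t e) = node_weight n t e"
  using assms
proof (induction t arbitrary: l r rule: measure_induct_rule[where f = size])
  case (less t)
  show ?case
  proof (cases "\<exists>f. t = Leaf f")
    case True
    then show ?thesis by (auto simp: pair_product_def)
  next
    case False
    then obtain ts where t: "t = Parallel ts" using less.prems(2) by (cases t) auto
    have dis: "part_edges_disjoint ts"
      using less.prems(1) unfolding t by (rule decomposes_part_edges_disjoint)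
    obtain i where i: "i < length ts" "e \<in> leaves (ts ! i)"
      using less.prems(3) unfolding t leaves_as_UN_nth by blast
    have mem: "ts ! i \<in> set ts" using i by simp
    then have "alternating_ser (ts ! i)" using less.prems(2) False unfolding t by simp
    then obtain ss where ss: "ts ! i = Series ss" by (cases "ts ! i") auto
    have dec: "decomposes G l r (Series ss)"
      using less.prems(1) mem unfolding t ss[symmetric] by (blast elim: decomposes.cases)
    then have dis': "part_edges_disjoint ss" by (rule decomposes_part_edges_disjoint)
    obtain j where j: "j < length ss" "e \<in> leaves (ss ! j)"
      using i(2) unfolding ss leaves_as_UN_nth by blast
    have mem': "ss ! j \<in> set ss" using j by simp
    have alt: "alternating_par (ss ! j) \<or> (\<exists>f. ss ! j = Leaf f)"
      using \<open>alternating_ser (ts ! i)\<close> mem' unfolding ss by auto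
    obtain vs where "decomposes G (vs ! j) (vs ! Suc j) (ss ! j)"
      using dec j(1) by (blast elim: decomposes.cases)
    moreover have "size (ss ! j) < size t"
    proof -
      have "size (ss ! j) < size (Series ss)" using size_list_estimation'[OF mem', of "size (ss ! j)" size] by simp
      also have "\<dots> < size t" using size_list_estimation'[OF mem, of "size (ts ! i)" size] by (simp add: t ss)
      finally show ?thesis .
    qed
    ultimately have IH: "pair_product n (chain (ss ! j) e) = node_weight n (ss ! j) e"
      using less.IH alt j(2) by blast
    have "chain t e = t # Series ss # chain (ss ! j) e"
      unfolding t chain_part(1)[OF dis i] unfolding ss chain_part(2)[OF dis' j] ..
    then have "pair_product n (chain t e) =
      phi n (card (leaves (Series ss))) / phi n (card (leaves (ss ! j))) * node_weight n (ss ! j) e"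
      by (simp only: pair_product_Cons2[OF chain_nonempty(1)] chain_nonempty(2) IH)
    also have "\<dots> = node_weight n t e"
      unfolding t node_weight_part(1)[OF dis i] unfolding ss node_weight_part(2)[OF dis' j] ..
    finally show ?thesis .
  qed
qed

lemma graph_weight_eq_node_weight:
  assumes "admissible_tree G l r T" "e \<in> leaves T"
  shows "graph_weight T e = node_weight (card (leaves T)) T e"
  using pair_product_chain[of G l r T e "card (leaves T)"] assms
  by (simp add: admissible_tree_def graph_weight_def pair_product_def Let_def)

section \<open>The largest principal angle with a coordinate subspace\<close>

lemma inner_transpose_mult:
  fixes A :: "real ^ 'n ^ 'm"
  shows "(transpose A *v x) \<bullet> y = x \<bullet> (A *v y)"
  by (simp add: transpose_matrix_vector dot_lmul_matrix)

lemma col_space_eq_range: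
  fixes A :: "real ^ 'n ^ 'm"
  shows "col_space A = range (\<lambda>x. A *v x)"
proof
  have "columns A \<subseteq> range (\<lambda>x. A *v x)"
    by (auto simp: columns_def matrix_vector_mult_basis[symmetric])
  moreover have "subspace (range (\<lambda>x. A *v x))"
    by (intro linear_subspace_image matrix_vector_mul_linear subspace_UNIV)
  ultimately show "col_space A \<subseteq> range (\<lambda>x. A *v x)"
    unfolding col_space_def by (rule span_minimal)
  show "range (\<lambda>x. A *v x) \<subseteq> col_space A"
    unfolding col_space_def using matrix_vector_mult_in_columnspace by blast
qed

lemma singular_matrix_swap:
  fixes A B :: "real ^ 'k ^ 'k"
  assumes "x \<noteq> 0" "(A ** B) *v x = 0"
  shows "\<exists>y. y \<noteq> 0 \<and> (B ** A) *v y = 0"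
proof -
  have "\<not> invertible (A ** B)"
    using assms by (auto simp: invertible_left_inverse matrix_left_invertible_ker)
  then have "det (A ** B) = 0" by (simp add: invertible_det_nz)
  then have "det (B ** A) = 0" by (auto simp: det_mul)
  then have "\<not> invertible (B ** A)" by (simp add: invertible_det_nz)
  then show ?thesis by (auto simp: invertible_left_inverse matrix_left_invertible_ker)
qed

text \<open>If \<open>x\<close> is an eigenvector of \<open>A ** B\<close>, then \<open>B *v x\<close> is one of \<open>B ** A\<close>, except that it may vanish for the
  eigenvalue \<open>0\<close>. That case is settled by determinants.\<close>

lemma eigenvalue_swap:
  fixes A B :: "real ^ 'k ^ 'k"
  assumes "x \<noteq> 0" "(A ** B) *v x = c *\<^sub>R x"
  shows "\<exists>y. y \<noteq> 0 \<and> (B ** A) *v y = c *\<^sub>R y"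
proof (cases "c = 0")
  case True
  then show ?thesis using singular_matrix_swap assms by auto
next
  case False
  have *: "A *v (B *v x) = c *\<^sub>R x"
    using assms(2) by (simp add: matrix_vector_mul_assoc)
  then have "B *v x \<noteq> 0" using False assms(1) by auto
  moreover have "(B ** A) *v (B *v x) = c *\<^sub>R (B *v x)"
    unfolding matrix_vector_mul_assoc[symmetric] *
    by (simp add: matrix_vector_mult_scaleR)
  ultimately show ?thesis by blast
qed

text \<open>Passing to the transpose moves the minimisation from \<open>E\<^sub>I\<close> to \<open>U\<close>, where the energy bound lives.\<close>

lemma singular_values_transpose:
  fixes A :: "real ^ 'k ^ 'k"
  shows "singular_values A = {sqrt c | c. \<exists>y. y \<noteq> 0 \<and> (A ** transpose A) *v y = c *\<^sub>R y}"
  unfolding singular_values_def using eigenvalue_swap by (metis (no_types, opaque_lifting))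

text \<open>Eigenvectors of a symmetric matrix for distinct eigenvalues are orthogonal.\<close>

lemma finite_singular_values:
  fixes A :: "real ^ 'k ^ 'k"
  shows "finite (singular_values A)"
proof -
  define S where "S = transpose A ** A"
  have sym: "(S *v x) \<bullet> y = x \<bullet> (S *v y)" for x y
    unfolding S_def matrix_vector_mul_assoc[symmetric] inner_transpose_mult
    by (metis inner_commute inner_transpose_mult)
  define C where "C = {c. \<exists>x. x \<noteq> 0 \<and> S *v x = c *\<^sub>R x}"
  have "\<forall>c \<in> C. \<exists>x. x \<noteq> 0 \<and> S *v x = c *\<^sub>R x" by (simp add: C_def)
  from bchoice[OF this] obtain f where f: "\<And>c. c \<in> C \<Longrightarrow> f c \<noteq> 0 \<and> S *v f c = c *\<^sub>R f c"
    by blast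
  have orth: "f c \<bullet> f d = 0" if "c \<in> C" "d \<in> C" "c \<noteq> d" for c d
  proof -
    have "c * (f c \<bullet> f d) = d * (f c \<bullet> f d)"
      using sym[of "f c" "f d"] f[OF that(1)] f[OF that(2)] by simp
    then show ?thesis using that(3) by simp
  qed
  have "inj_on f C"
  proof (rule inj_onI)
    fix c d assume "c \<in> C" "d \<in> C" "f c = f d"
    then show "c = d" using orth[of c d] f[of d] by auto
  qed
  moreover have "finite (f ` C)"
  proof (rule pairwise_orthogonal_imp_finite)
    show "pairwise orthogonal (f ` C)"
      unfolding pairwise_def orthogonal_def using orth by blast
  qed
  ultimately have "finite C" by (rule finite_imageD[rotated])
  then have "finite (sqrt ` C)" by simp
  moreover have "singular_values A = sqrt ` C"
    unfolding singular_values_def C_def S_def by blast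
  ultimately show ?thesis by simp
qed

text \<open>A lower bound of the Rayleigh quotient of \<open>A ** transpose A\<close> that is attained is its smallest eigenvalue:
  a positive semidefinite form can vanish only on its kernel, so the minimiser is an eigenvector.\<close>

lemma Min_singular_values:
  fixes A :: "real ^ 'k ^ 'k"
  assumes bound: "\<And>y. b * (y \<bullet> y) \<le> (transpose A *v y) \<bullet> (transpose A *v y)"
    and y0: "y0 \<noteq> 0" "b * (y0 \<bullet> y0) = (transpose A *v y0) \<bullet> (transpose A *v y0)"
  shows "Min (singular_values A) = sqrt b"
proof (rule Min_eqI[OF finite_singular_values])
  have form: "(transpose A *v y) \<bullet> (transpose A *v z) = ((A ** transpose A) *v y) \<bullet> z" for y z
    using inner_transpose_mult[of A z "transpose A *v y"]
    by (simp add: matrix_vector_mul_assoc[symmetric] inner_commute)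
  fix s assume "s \<in> singular_values A"
  then obtain c y where c: "s = sqrt c" "y \<noteq> 0" "(A ** transpose A) *v y = c *\<^sub>R y"
    unfolding singular_values_transpose by blast
  have "b * (y \<bullet> y) \<le> c * (y \<bullet> y)" using bound[of y] unfolding form c(3) by simp
  then show "sqrt b \<le> s" using c(1,2) by simp
next
  have form: "(transpose A *v y) \<bullet> (transpose A *v z) = ((A ** transpose A) *v y) \<bullet> z" for y z
    using inner_transpose_mult[of A z "transpose A *v y"]
    by (simp add: matrix_vector_mul_assoc[symmetric] inner_commute)
  define L where "L y = (A ** transpose A) *v y - b *\<^sub>R y" for y
  have L: "linear L" unfolding L_def
    by (intro linear_compose_sub matrix_vector_mul_linear linear_scale_self)
  have psd: "0 \<le> L y \<bullet> y" for y
    using bound[of y] unfolding form by (simp add: L_def inner_diff_left)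
  have sym: "L y \<bullet> z = L z \<bullet> y" for y z
    unfolding L_def inner_diff_left form[symmetric] by (simp add: inner_commute)
  have zero: "L y0 \<bullet> y0 = 0" using y0(2) unfolding form by (simp add: L_def inner_diff_left)
  define g where "g = L y0"
  have "g = 0"
  proof (rule ccontr)
    assume "g \<noteq> 0"
    then have G: "0 < g \<bullet> g" by simp
    define Q where "Q = L g \<bullet> g"
    \<comment> \<open>A step from \<open>y0\<close> against the gradient makes the form negative;
      \<open>Q + 1\<close> instead of \<open>Q\<close> avoids a zero denominator.\<close>
    define t where "t = (g \<bullet> g) / (Q + 1)"
    have Q: "0 \<le> Q" unfolding Q_def by (rule psd)
    have t: "0 < t" unfolding t_def using G Q by simp
    have "L (y0 - t *\<^sub>R g) \<bullet> (y0 - t *\<^sub>R g) = - 2 * t * (g \<bullet> g) + t * t * Q"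
      unfolding linear_diff[OF L] linear_scale[OF L] inner_diff_left inner_diff_right
      using zero sym[of g y0] by (simp add: g_def[symmetric] Q_def algebra_simps)
    then have "0 \<le> t * (t * Q - 2 * (g \<bullet> g))"
      using psd[of "y0 - t *\<^sub>R g"] by (simp add: algebra_simps)
    then have "2 * (g \<bullet> g) \<le> t * Q" using t by (simp add: zero_le_mult_iff)
    moreover have "t * Q \<le> g \<bullet> g"
      unfolding t_def using G Q by (simp add: field_simps)
    ultimately show False using G by simp
  qed
  then have "(A ** transpose A) *v y0 = b *\<^sub>R y0" by (simp add: g_def L_def)
  then show "sqrt b \<in> singular_values A"
    unfolding singular_values_transpose using y0(1) by blast
qed

lemma coordinate_subspace_iff: "v \<in> coordinate_subspace I \<longleftrightarrow> (\<forall>i. i \<notin> I \<longrightarrow> v $ i = 0)"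
proof
  have "(\<lambda>i. axis i 1) ` I \<subseteq> {v :: real ^ 'a. \<forall>i. i \<notin> I \<longrightarrow> v $ i = 0}"
    by (auto simp: axis_def)
  moreover have "subspace {v :: real ^ 'a. \<forall>i. i \<notin> I \<longrightarrow> v $ i = 0}"
    by (auto simp: subspace_def)
  ultimately have "coordinate_subspace I \<subseteq> {v :: real ^ 'a. \<forall>i. i \<notin> I \<longrightarrow> v $ i = 0}"
    unfolding coordinate_subspace_def by (rule span_minimal)
  then show "\<forall>i. i \<notin> I \<longrightarrow> v $ i = 0" if "v \<in> coordinate_subspace I"
    using that by blast
next
  assume v: "\<forall>i. i \<notin> I \<longrightarrow> v $ i = 0"
  have "v = (\<Sum>i\<in>UNIV. (v $ i) *\<^sub>R axis i 1)"
    using basis_expansion[of v] by (simp add: scalar_mult_eq_scaleR)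
  also have "\<dots> \<in> span ((\<lambda>i. axis i 1) ` I)"
  proof (rule span_sum)
    fix i
    show "(v $ i) *\<^sub>R axis i 1 \<in> span ((\<lambda>i. axis i 1) ` I)"
      using v by (cases "i \<in> I") (auto intro: span_scale span_base span_zero)
  qed
  finally show "v \<in> coordinate_subspace I" unfolding coordinate_subspace_def .
qed

lemma dim_coordinate_subspace: "dim (coordinate_subspace I) = card I"
proof -
  have "(\<lambda>i. axis i (1::real)) ` I \<subseteq> Basis" by (auto simp: Basis_vec_def)
  then have "independent ((\<lambda>i. axis i (1::real)) ` I)"
    using independent_Basis independent_mono by blast
  then have "dim (coordinate_subspace I) = card ((\<lambda>i. axis i (1::real)) ` I)"
    unfolding coordinate_subspace_def dim_span by (rule dim_eq_card_independent)
  also have "\<dots> = card I" by (intro card_image) (auto simp: inj_on_def axis_eq_axis)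
  finally show ?thesis .
qed

lemma ex_orthonormal_basis_matrix:
  fixes U :: "(real ^ 'n) set"
  assumes "subspace U" "dim U = CARD('k::finite)"
  shows "\<exists>Q :: real ^ 'k ^ 'n. orthonormal_basis_matrix Q U"
proof -
  obtain B where B: "B \<subseteq> U" "pairwise orthogonal B" "\<And>x. x \<in> B \<Longrightarrow> norm x = 1"
    "independent B" "card B = dim U" "span B = U"
    using orthonormal_basis_subspace[OF assms(1)] by metis
  have "finite B" using B(4) by (rule independent_imp_finite)
  then obtain f where f: "bij_betw f (UNIV :: 'k set) B"
    using B(5) assms(2) by (metis finite_same_card_bij finite)
  define Q :: "real ^ 'k ^ 'n" where "Q = (\<chi> i j. f j $ i)"
  have col: "column j Q = f j" for j by (simp add: column_def Q_def vec_eq_iff)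
  have "f i \<bullet> f j = (if i = j then 1 else 0)" for i j
  proof (cases "i = j")
    case True
    then show ?thesis using B(3)[of "f j"] f by (auto simp: bij_betw_def norm_eq_1)
  next
    case False
    then have "f i \<in> B" "f j \<in> B" "f i \<noteq> f j"
      using f by (auto simp: bij_betw_def inj_on_def)
    then show ?thesis using B(2) False by (auto simp: pairwise_def orthogonal_def)
  qed
  then have "transpose Q ** Q = mat 1"
    unfolding matrix_mult_transpose_dot_column col by (simp add: mat_def)
  moreover have "columns Q = B"
    using f unfolding columns_def col bij_betw_def by auto
  ultimately show ?thesis
    unfolding orthonormal_basis_matrix_def col_space_def using B(6) by blast
qed

lemma norm_orthonormal_mult:
  assumes "orthonormal_basis_matrix Q U"
  shows "(Q *v y) \<bullet> (Q *v z) = y \<bullet> z"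
  using assms inner_transpose_mult[of Q "Q *v y" z]
  by (simp add: orthonormal_basis_matrix_def matrix_vector_mul_assoc)

text \<open>Both sides are the squared length of the orthogonal projection of \<open>u\<close> to \<open>E\<^sub>I\<close>.\<close>

lemma coordinate_projection_norm:
  fixes Q :: "real ^ 'k ^ 'n::finite"
  assumes Q: "orthonormal_basis_matrix Q (coordinate_subspace I)"
  shows "(transpose Q *v u) \<bullet> (transpose Q *v u) = (\<Sum>i\<in>I. (u $ i)\<^sup>2)"
proof -
  \<comment> \<open>The projection of \<open>u\<close>.\<close>
  define w where "w = (\<chi> i. if i \<in> I then u $ i else 0)"
  have range: "coordinate_subspace I = range (\<lambda>x. Q *v x)"
    using Q by (simp add: orthonormal_basis_matrix_def col_space_eq_range)
  have "w \<in> coordinate_subspace I" by (simp add: coordinate_subspace_iff w_def)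
  then obtain z where z: "w = Q *v z" unfolding range by blast
  have "(transpose Q *v (u - w)) \<bullet> y = 0" for y
  proof -
    have "Q *v y \<in> coordinate_subspace I" unfolding range by blast
    then have *: "(u - w) $ i * (Q *v y) $ i = 0" for i
      by (cases "i \<in> I") (simp_all add: coordinate_subspace_iff w_def)
    show ?thesis unfolding inner_transpose_mult unfolding inner_vec_def
      by (simp only: inner_real_def * sum.neutral_const)
  qed
  then have "transpose Q *v (u - w) = 0" by (metis inner_eq_zero_iff)
  then have "transpose Q *v u = transpose Q *v w" by (simp add: matrix_vector_mult_diff_distrib)
  also have "\<dots> = z"
    using Q unfolding z by (simp add: orthonormal_basis_matrix_def matrix_vector_mul_assoc)
  finally have "(transpose Q *v u) \<bullet> (transpose Q *v u) = w \<bullet> w"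
    using norm_orthonormal_mult[OF Q, of z z] z by simp
  also have "\<dots> = (\<Sum>i\<in>UNIV. if i \<in> I then (u $ i)\<^sup>2 else 0)"
    unfolding inner_vec_def w_def by (intro sum.cong) (auto simp: power2_eq_square)
  also have "\<dots> = (\<Sum>i\<in>I. (u $ i)\<^sup>2)" by (simp add: sum.If_cases)
  finally show ?thesis .
qed

text \<open>The value does not depend on the choice of the two orthonormal bases, which makes the definite
  description in \<open>theta_max\<close> meaningful.\<close>

lemma theta_max_coordinate_subspace:
  fixes U :: "(real ^ 'n::finite) set"
  assumes U: "subspace U" "dim U = CARD('k::finite)" and I: "card I = CARD('k)"
    and bound: "\<And>u. u \<in> U \<Longrightarrow> b * (u \<bullet> u) \<le> (\<Sum>i\<in>I. (u $ i)\<^sup>2)"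
    and u0: "u0 \<in> U" "u0 \<noteq> 0" "b * (u0 \<bullet> u0) = (\<Sum>i\<in>I. (u0 $ i)\<^sup>2)"
  shows "theta_max TYPE('k) U (coordinate_subspace I) = arccos (sqrt b)"
proof -
  have Min: "Min (singular_values (transpose QU ** QV)) = sqrt b"
    if QU: "orthonormal_basis_matrix QU U" and QV: "orthonormal_basis_matrix QV (coordinate_subspace I)"
    for QU QV :: "real ^ 'k ^ 'n"
  proof -
    have range: "U = range (\<lambda>x. QU *v x)"
      using QU by (simp add: orthonormal_basis_matrix_def col_space_eq_range)
    obtain y0 where y0: "u0 = QU *v y0" using u0(1) unfolding range by blast
    have form: "(transpose (transpose QU ** QV) *v y) \<bullet> (transpose (transpose QU ** QV) *v y) =
      (\<Sum>i\<in>I. ((QU *v y) $ i)\<^sup>2)" for y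
      using coordinate_projection_norm[OF QV, of "QU *v y"]
      by (simp add: matrix_transpose_mul matrix_vector_mul_assoc)
    show ?thesis
    proof (rule Min_singular_values)
      fix y
      have "QU *v y \<in> U" unfolding range by blast
      from bound[OF this] show "b * (y \<bullet> y) \<le>
        (transpose (transpose QU ** QV) *v y) \<bullet> (transpose (transpose QU ** QV) *v y)"
        unfolding form norm_orthonormal_mult[OF QU] .
    next
      show "y0 \<noteq> 0" using u0(2) y0 by auto
      show "b * (y0 \<bullet> y0) =
        (transpose (transpose QU ** QV) *v y0) \<bullet> (transpose (transpose QU ** QV) *v y0)"
        using u0(3) unfolding form y0 norm_orthonormal_mult[OF QU] .
    qed
  qed
  have pos: "0 < u0 \<bullet> u0" using u0(2) by simp
  have "0 \<le> b * (u0 \<bullet> u0)" unfolding u0(3) by (intro sum_nonneg) simp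
  then have b0: "0 \<le> b" using pos by (simp add: zero_le_mult_iff)
  have "b * (u0 \<bullet> u0) \<le> 1 * (u0 \<bullet> u0)"
  proof -
    have "(\<Sum>i\<in>I. (u0 $ i)\<^sup>2) \<le> (\<Sum>i\<in>UNIV. (u0 $ i)\<^sup>2)" by (intro sum_mono2) auto
    then show ?thesis unfolding u0(3) by (simp add: inner_vec_def power2_eq_square)
  qed
  then have b1: "b \<le> 1" using pos by simp
  obtain QU :: "real ^ 'k ^ 'n" where QU: "orthonormal_basis_matrix QU U"
    using ex_orthonormal_basis_matrix[OF U] by blast
  have "subspace (coordinate_subspace I)" unfolding coordinate_subspace_def by (rule subspace_span)
  then obtain QV :: "real ^ 'k ^ 'n" where QV: "orthonormal_basis_matrix QV (coordinate_subspace I)"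
    using ex_orthonormal_basis_matrix dim_coordinate_subspace[of I] I by metis
  show ?thesis unfolding theta_max_def
  proof (rule the_equality)
    have "0 \<le> sqrt b" "- 1 \<le> sqrt b" "sqrt b \<le> 1"
      using b0 b1 order_trans[of "- 1" 0 "sqrt b"] by simp_all
    then have "cos (arccos (sqrt b)) = sqrt b" "0 \<le> arccos (sqrt b)" "arccos (sqrt b) \<le> pi / 2"
      by (simp_all only: cos_arccos arccos_lbound arccos_le_pi2)
    then show "0 \<le> arccos (sqrt b) \<and> arccos (sqrt b) \<le> pi / 2 \<and>
     (\<exists>(Q\<^sub>U :: real ^ 'k ^ 'n) (Q\<^sub>V :: real ^ 'k ^ 'n).
        orthonormal_basis_matrix Q\<^sub>U U \<and> orthonormal_basis_matrix Q\<^sub>V (coordinate_subspace I) \<and>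
        cos (arccos (sqrt b)) = Min (singular_values (transpose Q\<^sub>U ** Q\<^sub>V)))"
      using QU QV Min by metis
  next
    fix \<theta>
    assume *: "0 \<le> \<theta> \<and> \<theta> \<le> pi / 2 \<and>
     (\<exists>(Q\<^sub>U :: real ^ 'k ^ 'n) (Q\<^sub>V :: real ^ 'k ^ 'n).
        orthonormal_basis_matrix Q\<^sub>U U \<and> orthonormal_basis_matrix Q\<^sub>V (coordinate_subspace I) \<and>
        cos \<theta> = Min (singular_values (transpose Q\<^sub>U ** Q\<^sub>V)))"
    then have "cos \<theta> = sqrt b" using Min by metis
    moreover have "arccos (cos \<theta>) = \<theta>" using * pi_gt_zero by (intro arccos_cos) linarith+
    ultimately show "\<theta> = arccos (sqrt b)" by simp
  qed
qed

section \<open>The cut space of the weighted graph\<close>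

text \<open>In the column of a loop the incidence matrix would have the entry \<open>1\<close> instead of \<open>0\<close>.\<close>

lemma decomposed_edge_proper:
  assumes "decomposes G l r t" "e \<in> leaves t"
  shows "head G e \<noteq> tail G e"
  using assms
proof (induction rule: decomposes.induct)
  case (edge f l r)
  then show ?case by (auto simp: ends_def)
next
  case (parallel ts l r)
  then obtain t where "t \<in> set ts" "e \<in> leaves t" by auto
  then show ?case using parallel.IH by blast
next
  case (series ts vs l r)
  then obtain i where "i < length ts" "e \<in> leaves (ts ! i)" unfolding leaves_as_UN_nth by blast
  then show ?case using series.IH by blast
qed

lemma root_part_proper:
  assumes dec: "decomposes G l r (Parallel ts)" and len: "2 \<le> length ts" and i: "i < length ts"
  shows "decomposes G l r (ts ! i)"
    and "card (leaves (ts ! i)) < card (leaves (Parallel ts))"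
proof -
  have sub: "decomposes G l r (ts ! j)" if "j < length ts" for j
    using dec nth_mem[OF that] by (blast elim: decomposes.cases)
  then show "decomposes G l r (ts ! i)" using i .
  have "\<exists>j < length ts. j \<noteq> i" using len by (intro exI[of _ "if i = 0 then 1 else 0"]) auto
  then obtain j where j: "j < length ts" "j \<noteq> i" by blast
  have "leaves (ts ! j) \<noteq> {}" using card_leaves_pos[OF sub[OF j(1)]] by auto
  moreover have "leaves (ts ! i) \<inter> leaves (ts ! j) = {}"
    using part_edges_disjointD[OF decomposes_part_edges_disjoint(1)[OF dec]] i j by blast
  ultimately have "leaves (ts ! i) \<subset> leaves (Parallel ts)"
    using i j(1) unfolding leaves_as_UN_nth by blast
  then show "card (leaves (ts ! i)) < card (leaves (Parallel ts))"
    by (rule psubset_card_mono[OF finite_leaves])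
qed

definition weighted_diff :: "('v::finite, 'e::finite) pre_digraph \<Rightarrow> ('e \<Rightarrow> real) \<Rightarrow> real ^ 'v \<Rightarrow> real ^ 'e" where
  "weighted_diff G w x = (\<chi> e. sqrt (w e) * edge_diff G (($) x) e)"

lemma cut_matrix_mult:
  fixes G :: "('v::finite, 'e::finite) pre_digraph"
  assumes "\<And>e. head G e \<noteq> tail G e"
  shows "(diag_sqrt (diag_matrix w) ** transpose (incidence_matrix G)) *v x = weighted_diff G w x"
proof -
  have B: "(transpose (incidence_matrix G) *v x) $ e = edge_diff G (($) x) e" for e
  proof -
    have "(transpose (incidence_matrix G) *v x) $ e =
      (\<Sum>v\<in>UNIV. (if v = head G e then x $ v else 0) - (if v = tail G e then x $ v else 0))"
      unfolding matrix_vector_mult_def incidence_matrix_def transpose_def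
      using assms[of e] by (auto intro!: sum.cong)
    then show ?thesis by (simp add: sum_subtractf edge_diff_def)
  qed
  have "(diag_sqrt (diag_matrix w) *v z) $ e = sqrt (w e) * z $ e" for z e
  proof -
    have "(diag_sqrt (diag_matrix w) *v z) $ e = (\<Sum>f\<in>UNIV. if e = f then sqrt (w e) * z $ e else 0)"
      unfolding matrix_vector_mult_def diag_sqrt_def diag_matrix_def vec_lambda_beta
      by (intro sum.cong) auto
    then show ?thesis by simp
  qed
  then show ?thesis
    unfolding matrix_vector_mul_assoc[symmetric] by (simp add: vec_eq_iff weighted_diff_def B del: transpose_matrix_vector)
qed

lemma linear_weighted_diff: "linear (weighted_diff G w)"
  by (rule linearI) (simp_all add: weighted_diff_def edge_diff_def vec_eq_iff algebra_simps)

text \<open>The kernel consists of the constant potentials. It is removed by grounding the potentials at \<open>l\<close>.\<close>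

lemma dim_cut_space:
  fixes G :: "('v::finite, 'e::finite) pre_digraph"
  assumes dec: "decomposes G l r T" and T: "leaves T = UNIV" "node_verts G T = UNIV"
    and w: "\<And>e. 0 < w e"
  shows "dim (range (weighted_diff G w)) = CARD('v) - 1"
proof -
  let ?f = "weighted_diff G w"
  define K where "K = {x :: real ^ 'v. axis l 1 \<bullet> x = 0}"
  have K: "x \<in> K \<longleftrightarrow> x $ l = 0" for x by (simp add: K_def inner_axis')
  have subK: "subspace K" unfolding K_def by (rule subspace_hyperplane)
  have "?f x \<in> ?f ` K" for x
  proof (rule image_eqI)
    show "?f x = ?f (x - (\<chi> v. x $ l))" by (simp add: weighted_diff_def edge_diff_def vec_eq_iff)
    show "x - (\<chi> v. x $ l) \<in> K" by (simp add: K)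
  qed
  then have range: "range ?f = ?f ` K" by blast
  have "inj_on ?f K"
  proof (rule inj_onI)
    fix x y assume *: "x \<in> K" "y \<in> K" "?f x = ?f y"
    have "sqrt (w e) * edge_diff G (($) x) e = sqrt (w e) * edge_diff G (($) y) e" for e
      using *(3) by (simp add: weighted_diff_def vec_eq_iff)
    then have "edge_diff G (($) x) e = edge_diff G (($) y) e" for e
      using w[of e] by (metis mult_cancel_left order_less_irrefl real_sqrt_eq_zero_cancel_iff)
    then have "edge_diff G (($) (x - y)) e = 0" for e
      by (simp add: edge_diff_def algebra_simps)
    then have "(x - y) $ v = (x - y) $ l" for v
      using potential_constant[OF dec, of "($) (x - y)" v] T by simp
    then show "x = y" using *(1,2) by (simp add: K vec_eq_iff)
  qed
  moreover have "span K = K" using subK by (rule span_eq_iff[THEN iffD2])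
  ultimately have "inj_on ?f (span K)" by (simp only:)
  then have "dim (?f ` K) = dim K" by (rule dim_image_eq[OF linear_weighted_diff])
  also have "\<dots> = DIM(real ^ 'v) - 1"
    unfolding K_def by (rule dim_special_hyperplane) (auto simp: Basis_vec_def)
  finally show ?thesis unfolding range by simp
qed

text \<open>Such a vector of \<open>U\<close> is orthogonal to \<open>E\<^sub>I\<close>.\<close>

lemma flat_potential_normal_vector:
  fixes G :: "('v::finite, 'e::finite) pre_digraph"
  assumes dec: "decomposes G l r T" and T: "leaves T = UNIV" "node_verts G T = UNIV"
    and w: "\<And>e. 0 < w e" and x: "flat G I T x" "x u \<noteq> x v"
  shows "\<exists>z \<in> range (weighted_diff G w). z \<noteq> 0 \<and> (\<Sum>i\<in>I. (z $ i)\<^sup>2) = 0"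
proof -
  define z where "z = weighted_diff G w (\<chi> v. x v)"
  have z: "z $ e = sqrt (w e) * edge_diff G x e" for e
    by (simp add: z_def weighted_diff_def edge_diff_def)
  have "z \<noteq> 0"
  proof
    assume "z = 0"
    then have "sqrt (w e) * edge_diff G x e = 0" for e using z[of e] by simp
    then have "edge_diff G x e = 0" for e
      using w[of e] by (metis mult_eq_0_iff order_less_irrefl real_sqrt_eq_zero_cancel_iff)
    then have "x v = x l" for v using potential_constant[OF dec, of x v] T by simp
    then show False using x(2) by metis
  qed
  moreover have "(\<Sum>i\<in>I. (z $ i)\<^sup>2) = 0"
    using x(1) T by (intro sum.neutral) (simp add: z flat_def)
  ultimately show ?thesis unfolding z_def by blast
qed

section \<open>Principal angles with the coordinate subspaces\<close>

theorem theorem3p1: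
  fixes G :: "('v::finite, 'e::finite) pre_digraph"
    and l r :: 'v
    and T :: "'e sp_tree"
    and n :: nat
    and B :: "real ^ 'e ^ 'v"
    and W :: "real ^ 'e ^ 'e"
    and U :: "(real ^ 'e) set"
  assumes "two_sp_graph G"
    and "verts G = UNIV" and "arcs G = UNIV"
    and "card (verts G) = CARD('k::finite) + 1"
    and "card (arcs G) = n"
    and "admissible_tree G l r T"
    and "B = incidence_matrix G"
    and "W = diag_matrix (graph_weight T)"
    and "U = col_space (diag_sqrt W ** transpose B)"
  shows "\<forall>I :: 'e set. card I = CARD('k) \<longrightarrow>
    theta_max TYPE('k) U (coordinate_subspace I) = arccos (1 / sqrt (real n)) \<or>
    theta_max TYPE('k) U (coordinate_subspace I) = pi / 2"
proof (intro allI impI)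
  fix I :: "'e set"
  assume I: "card I = CARD('k)"
  have dec: "decomposes G l r T" and T: "leaves T = UNIV" "node_verts G T = UNIV"
    using assms(2,3,6) by (simp_all add: admissible_tree_def)
  obtain ts where ts: "T = Parallel ts" "2 \<le> length ts"
    using assms(6) by (auto simp: admissible_tree_def)
  have dec': "decomposes G l r (Parallel ts)" using dec unfolding ts(1) .
  have dis: "part_edges_disjoint ts" using dec' by (rule decomposes_part_edges_disjoint)
  have n: "n = card (leaves T)" using assms(3,5) T(1) by simp
  define w where "w = graph_weight T"
  have w_eq: "w e = node_weight n T e" for e
    unfolding w_def n using graph_weight_eq_node_weight[OF assms(6)] T(1) by simp
  have w: "0 < w e" for e
  proof -
    have "e \<in> leaves (Parallel ts)" using T(1) ts(1) by simp
    then obtain i where i: "i < length ts" "e \<in> leaves (ts ! i)" unfolding leaves_as_UN_nth by blast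
    show ?thesis
      unfolding w_eq ts(1) node_weight_part(1)[OF dis i]
      using node_weight_pos[OF root_part_proper(1)[OF dec' ts(2) i(1)] i(2)]
        root_part_proper(2)[OF dec' ts(2) i(1)] n ts(1) by simp
  qed
  have U: "U = range (weighted_diff G w)"
    unfolding assms(7-9) col_space_eq_range w_def[symmetric]
    using cut_matrix_mult[of G w] decomposed_edge_proper[OF dec] T(1) by simp
  have subU: "subspace U"
    unfolding U by (intro linear_subspace_image linear_weighted_diff subspace_UNIV)
  have dimU: "dim U = CARD('k)"
    unfolding U dim_cut_space[OF dec T w] using assms(2,4) by simp
  note theta = theta_max_coordinate_subspace[OF subU dimU I]
  have right_angle: "theta_max TYPE('k) U (coordinate_subspace I) = pi / 2"
    if x: "flat G I T x" "x u \<noteq> x v" for x u v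
  proof -
    obtain z where "z \<in> U" "z \<noteq> 0" "(\<Sum>i\<in>I. (z $ i)\<^sup>2) = 0"
      using flat_potential_normal_vector[where w = w, OF dec T w x, folded U] by blast
    then have "theta_max TYPE('k) U (coordinate_subspace I) = arccos (sqrt 0)"
      by (intro theta[of 0 z]) (auto intro: sum_nonneg)
    then show ?thesis by simp
  qed
  show "theta_max TYPE('k) U (coordinate_subspace I) = arccos (1 / sqrt (real n)) \<or>
    theta_max TYPE('k) U (coordinate_subspace I) = pi / 2"
  proof (cases "reaches I T \<and> connects I T")
    case False
    then consider "\<not> reaches I T" | "\<not> connects I T" by blast
    then have "\<exists>x u v. flat G I T x \<and> x u \<noteq> x v"
    proof cases
      case 1
      then show ?thesis using isolated_potential[OF dec 1] by metis
    next
      case 2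
      have "\<exists>x. x l = 0 \<and> x r = 1 \<and> flat G I T x" by (rule flat_potential[OF dec]) (use 2 in blast)
      then show ?thesis by (metis zero_neq_one)
    qed
    then show ?thesis using right_angle by blast
  next
    case True
    \<comment> \<open>\<open>k - 1\<close> inner vertices and a connecting set of \<open>k\<close> edges: equality in the count excludes cycles.\<close>
    have "card (UNIV - {l, r}) = CARD('k) - 1"
      using terminals_distinct[OF dec] assms(2,4) by (simp add: card_Diff_subset)
    then have "CARD('k) - 1 + 1 + of_bool (\<not> cycle_free I T) \<le> CARD('k)"
      using card_inner_verts_le[of G l r T I] dec True T I by simp
    then have cf: "cycle_free I T"
      by (cases "cycle_free I T") simp_all
    have "reduces_to (energy G n I (Parallel ts)) l r (conductance n I (Parallel ts))"
    proof (rule energy_reduces_parallel[OF dec'])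
      fix i assume i: "i < length ts"
      then have "ts ! i \<in> set ts" by simp
      then have "reaches I (ts ! i)" "cycle_free I (ts ! i)" using True cf ts(1) by simp_all
      then show "reduces_to (energy G n I (ts ! i)) l r (conductance n I (ts ! i))"
        using root_part_proper[OF dec' ts(2) i] n ts(1) by (intro energy_reduces) simp_all
    qed (use cf ts(1) in simp)
    \<comment> \<open>The root has \<open>n\<close> edges and \<open>I\<close> connects its terminals, so its conductance is \<open>n - n\<close>.\<close>
    then have red: "reduces_to (energy G n I T) l r 0"
      using True n unfolding ts(1)[symmetric] conductance_def by simp
    have npos: "0 < real n" using card_leaves_pos[OF dec] n by simp
    have energy: "energy G n I T x = real n * (\<Sum>i\<in>I. (z $ i)\<^sup>2) - z \<bullet> z"
      if z: "z = weighted_diff G w (\<chi> v. x v)" for x z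
    proof -
      have sq: "(z $ e)\<^sup>2 = node_weight n T e * (edge_diff G x e)\<^sup>2" for e
        using w[of e] by (simp add: z weighted_diff_def edge_diff_def power_mult_distrib w_eq[symmetric])
      have "energy G n I T x = (\<Sum>e\<in>UNIV. real n * (if e \<in> I then (z $ e)\<^sup>2 else 0) - (z $ e)\<^sup>2)"
        unfolding energy_def T(1) sq by (intro sum.cong) (auto simp: algebra_simps)
      also have "\<dots> = real n * (\<Sum>i\<in>I. (z $ i)\<^sup>2) - z \<bullet> z"
        by (simp add: sum_subtractf sum_distrib_left[symmetric] sum.If_cases inner_vec_def power2_eq_square)
      finally show ?thesis .
    qed
    have bound: "1 / real n * (z \<bullet> z) \<le> (\<Sum>i\<in>I. (z $ i)\<^sup>2)" if z_in: "z \<in> U" for z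
    proof -
      obtain y where y: "z = weighted_diff G w y" using z_in unfolding U by blast
      have "0 \<le> energy G n I T (($) y)" using red unfolding reduces_to_def by simp
      moreover have "z = weighted_diff G w (\<chi> v. y $ v)" using y by simp
      ultimately show ?thesis using energy npos by (simp add: field_simps)
    qed
    obtain x where x: "x l = 0" "x r = 1" "energy G n I T x = 0"
      using red unfolding reduces_to_def by (metis mult_zero_left)
    define z where "z = weighted_diff G w (\<chi> v. x v)"
    have zU: "z \<in> U" unfolding U z_def by blast
    have eq: "1 / real n * (z \<bullet> z) = (\<Sum>i\<in>I. (z $ i)\<^sup>2)"
      using energy[OF z_def] x(3) npos by (simp add: field_simps)
    have "z \<noteq> 0"
    proof
      assume "z = 0"
      then have "sqrt (w e) * edge_diff G x e = 0" for e
        unfolding z_def by (simp add: vec_eq_iff weighted_diff_def edge_diff_def)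
      then have "flat G UNIV T x"
        using w by (metis flat_def mult_eq_0_iff order_less_irrefl real_sqrt_eq_zero_cancel_iff)
      then have "x r = x l" using potential_constant[OF dec, of x r] T by (simp add: flat_def)
      then show False using x by simp
    qed
    from theta[OF bound zU this eq]
    have "theta_max TYPE('k) U (coordinate_subspace I) = arccos (1 / sqrt (real n))"
      by (simp add: real_sqrt_divide)
    then show ?thesis by blast
  qed
qed

end
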